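(* Let $H$ be a random graph $G(n,p)$ with $p \geq 86\frac{\ln n}{n}$. Then the Distributed Rotation Algorithm (DRA) run on $H$ constructs a Hamiltonian cycle of $H$ within $7n\ln n$ steps, with probability of success $1 - O(\frac{1}{n^3})$.
   Context: $G(n,p)$ denotes the random graph on $n$ labelled vertices in which each of the $\binom{n}{2}$ possible edges is present independently with probability $p$. Probabilities are over the random graph and the algorithm's random choices. Distributed Rotation Algorithm (DRA) on a graph $H$ with $n$ vertices: each node keeps a list of "unused" incident edges (initially all of them) and a path index (initially $0$). One node becomes the head with index $1$. The current path is $v_1,\dots,v_h$ ($v_i$ = node with index $i$), with head $v_h$. In one step, the head picks an edge $(v_h,u)$ uniformly at random from its unused list and removes it from the unused lists of both endpoints. If $u$ is not on the path, $u$ gets index $h+1$ and becomes the head (extension). If $u=v_j$ is on the path: if $h=n$ and $j=1$ the algorithm stops with success (the path plus edge $(v_n,v_1)$ is a Hamiltonian cycle); otherwise $v_j$ broadcasts $(h,j)$, each node with index $i$, $j<i\le h$, renumbers itself to $h+j+1-i$ (so the path becomes $v_1,\dots,v_j,v_h,v_{h-1},\dots,v_{j+1}$), and the node now having index $h$ becomes the head (rotation). A step is one extension or one rotation. *)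

theory Defs
  imports "HOL-Probability.Probability"
begin

text \<open>The labelled vertices are \<open>0, \<dots>, n - 1\<close>; a graph on them is given by its set of edges.\<close>

definition all_edges :: "nat \<Rightarrow> nat set set" where
  "all_edges n = {e. e \<subseteq> {..<n} \<and> card e = 2}"

definition gnp :: "nat \<Rightarrow> real \<Rightarrow> nat set set pmf" where
  "gnp n p = map_pmf (\<lambda>present. {e \<in> all_edges n. present e})
     (Pi_pmf (all_edges n) False (\<lambda>_. bernoulli_pmf p))"

definition ham_cycle :: "nat \<Rightarrow> nat set set \<Rightarrow> nat list \<Rightarrow> bool" where
  "ham_cycle n E vs \<longleftrightarrow>
     3 \<le> n \<and> length vs = n \<and> distinct vs \<and> set vs = {..<n} \<and>
     (\<forall>i. Suc i < n \<longrightarrow> {vs ! i, vs ! Suc i} \<in> E) \<and> {last vs, hd vs} \<in> E"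

text \<open>
  In \<open>Running U vs\<close> the current path is \<open>vs\<close>, starting at the node of index 1 and ending at the
  head, so the path index of a node is its 1-based position in \<open>vs\<close>. The unused list of \<open>v\<close> is
  \<open>U v\<close>, where an incident edge is represented by its other endpoint.
  \<open>Stuck\<close> is reached when the unused list of the head is empty.
\<close>

datatype dra_state =
    Running "nat \<Rightarrow> nat set" "nat list"
  | Success "nat list"
  | Stuck

definition path_index :: "nat list \<Rightarrow> nat \<Rightarrow> nat" where
  "path_index vs u = length (takeWhile (\<lambda>w. w \<noteq> u) vs) + 1"

text \<open>Sending each index \<open>i\<close> with \<open>j < i \<le> h\<close> to \<open>h + j + 1 - i\<close> reverses the path after \<open>v\<^sub>j\<close>.\<close>

definition rotate_path :: "nat \<Rightarrow> nat list \<Rightarrow> nat list" where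
  "rotate_path j vs = take j vs @ rev (drop j vs)"

definition remove_edge :: "nat \<Rightarrow> nat \<Rightarrow> (nat \<Rightarrow> nat set) \<Rightarrow> nat \<Rightarrow> nat set" where
  "remove_edge v u U = U(v := U v - {u}, u := U u - {v})"

definition dra_init :: "nat set set \<Rightarrow> nat \<Rightarrow> dra_state" where
  "dra_init E s = Running (\<lambda>v. {u. u \<noteq> v \<and> {v, u} \<in> E}) [s]"

definition dra_move :: "nat \<Rightarrow> (nat \<Rightarrow> nat set) \<Rightarrow> nat list \<Rightarrow> nat \<Rightarrow> dra_state" where
  "dra_move n U vs u =
     (let U' = remove_edge (last vs) u U; j = path_index vs u in
      if u \<notin> set vs then Running U' (vs @ [u])
      else if length vs = n \<and> j = 1 then Success vs
      else Running U' (rotate_path j vs))"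

fun dra_step :: "nat \<Rightarrow> dra_state \<Rightarrow> dra_state pmf" where
  "dra_step n (Running U vs) =
     (if U (last vs) = {} then return_pmf Stuck
      else map_pmf (dra_move n U vs) (pmf_of_set (U (last vs))))"
| "dra_step n (Success vs) = return_pmf (Success vs)"
| "dra_step n Stuck = return_pmf Stuck"

text \<open>The distribution of the state after \<open>k\<close> steps; \<open>Success\<close> and \<open>Stuck\<close> are absorbing.\<close>

primrec dra_run :: "nat \<Rightarrow> nat set set \<Rightarrow> nat \<Rightarrow> nat \<Rightarrow> dra_state pmf" where
  "dra_run n E s 0 = return_pmf (dra_init E s)"
| "dra_run n E s (Suc k) = bind_pmf (dra_run n E s k) (dra_step n)"

definition dra_on_gnp :: "nat \<Rightarrow> real \<Rightarrow> nat \<Rightarrow> nat \<Rightarrow> (nat set set \<times> dra_state) pmf" where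
  "dra_on_gnp n p s k =
     bind_pmf (gnp n p) (\<lambda>E. map_pmf (\<lambda>st. (E, st)) (dra_run n E s k))"

definition constructs_ham_cycle :: "nat \<Rightarrow> (nat set set \<times> dra_state) set" where
  "constructs_ham_cycle n = {(E, st). \<exists>vs. st = Success vs \<and> ham_cycle n E vs}"

end

theory Submission
  imports Defs "HOL-Real_Asymp.Real_Asymp"
begin

text \<open>
  The sequence of picked vertices determines the path and the used edges, so the probability of a
  run \<open>h\<close> is the average over the graph of a product of reciprocals of numbers of unused edges.
  Exchanging in the graph the edges from the head to two candidates \<open>u\<close> and \<open>u'\<close> preserves the law
  of the graph and changes the factor of each time at which \<open>u\<close> or \<open>u'\<close> was the head only slightly.
  Hence the next vertex is picked almost uniformly: a vertex that has never been the head is at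
  least as likely as any other one, the start vertex, which has been the head only once, nearly so,
  and no vertex is more likely than \<open>1.49 / n\<close>.

  The upper bound, with the potential \<open>2\<close> to the number of used edges at a vertex, shows that no
  vertex has more than \<open>36 ln n\<close> used edges, while all degrees are at least \<open>58 ln n\<close>; thus no head
  gets stuck. The lower bound makes a potential that measures the number of vertices off the path
  decay by the factor \<open>1 - 2 / (3 n)\<close> per step until the cycle is closed, and
  \<open>n (1 - 2 / (3 n))\<^bsup>7 n ln n\<^esup>\<close> is below \<open>n\<^bsup>-3\<^esup>\<close>.
\<close>

section \<open>Random graphs\<close>

lemma finite_all_edges: "finite (all_edges n)"
  unfolding all_edges_def by (rule finite_subset[of _ "Pow {..<n}"]) auto

lemma pair_in_all_edges: "{x, y} \<in> all_edges n \<longleftrightarrow> x < n \<and> y < n \<and> x \<noteq> y"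
  by (auto simp: all_edges_def card_2_iff doubleton_eq_iff)

text \<open>Functions that select the same edge set differ only outside \<open>all_edges n\<close>,
  where \<open>Pi_pmf\<close> almost surely takes its default value \<open>False\<close>; so the
  preimage of \<open>E\<close> is a single function up to a null set.\<close>

lemma pmf_gnp:
  assumes "E \<subseteq> all_edges n"
  shows "pmf (gnp n p) E = (\<Prod>e\<in>all_edges n. pmf (bernoulli_pmf p) (e \<in> E))"
proof -
  let ?P = "Pi_pmf (all_edges n) False (\<lambda>_. bernoulli_pmf p)"
  let ?f = "\<lambda>present. {e \<in> all_edges n. present e}"
  have "pmf (gnp n p) E = measure ?P (?f -` {E})" by (simp add: gnp_def pmf_map)
  also have "\<dots> = measure ?P {\<lambda>e. e \<in> E}"
  proof (rule measure_prob_cong_0)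
    fix g assume g: "g \<in> ?f -` {E} - {\<lambda>e. e \<in> E}"
    then obtain e where "g e \<noteq> (e \<in> E)" by (auto simp: fun_eq_iff)
    with g have "e \<notin> all_edges n" "g e \<noteq> False" using assms by auto
    thus "pmf ?P g = 0" by (intro pmf_Pi_outside finite_all_edges) blast
  qed (use assms in auto)
  also have "\<dots> = pmf ?P (\<lambda>e. e \<in> E)" by (simp add: measure_pmf_single)
  also have "\<dots> = (\<Prod>e\<in>all_edges n. pmf (bernoulli_pmf p) (e \<in> E))"
    by (rule pmf_Pi') (use assms finite_all_edges in auto)
  finally show ?thesis .
qed

lemma set_pmf_gnp: "set_pmf (gnp n p) \<subseteq> Pow (all_edges n)"
  by (auto simp: gnp_def)

lemma transpose_image_subset:
  assumes "a \<in> S" "b \<in> S" "E \<subseteq> S"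
  shows "Transposition.transpose a b ` E \<subseteq> S"
  using assms by (auto simp: Transposition.transpose_def)

text \<open>All edges carry the same probability, so the exchange merely permutes the factors of the
  product.\<close>

lemma pmf_gnp_transpose:
  assumes "E \<subseteq> all_edges n" "a \<in> all_edges n" "b \<in> all_edges n"
  shows "pmf (gnp n p) (Transposition.transpose a b ` E) = pmf (gnp n p) E"
proof -
  have "(\<Prod>e\<in>all_edges n. pmf (bernoulli_pmf p) (Transposition.transpose a b e \<in> E)) =
        (\<Prod>e\<in>all_edges n. pmf (bernoulli_pmf p) (e \<in> E))"
    by (rule prod.reindex_bij_betw[OF bij_betw_transpose_iff]) (use assms in simp)
  thus ?thesis
    using assms transpose_image_subset[OF assms(2,3,1)]
    by (simp add: pmf_gnp in_transpose_image_iff)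
qed

section \<open>Expectations of functions with values in the unit interval\<close>

lemma integrable_measure_pmf_unit:
  fixes f :: "'a \<Rightarrow> real"
  assumes "\<And>x. 0 \<le> f x" "\<And>x. f x \<le> 1"
  shows "integrable (measure_pmf M) f"
  by (rule measure_pmf.integrable_const_bound[where B = 1]) (use assms in auto)

lemma expectation_unit:
  fixes f :: "'a \<Rightarrow> real"
  assumes "\<And>x. 0 \<le> f x" "\<And>x. f x \<le> 1"
  shows "0 \<le> measure_pmf.expectation M f" "measure_pmf.expectation M f \<le> 1"
  using assms integrable_measure_pmf_unit[OF assms, of M]
  by (auto intro: measure_pmf.integral_le_const)

lemma nn_integral_eq_expectation_unit:
  fixes f :: "'a \<Rightarrow> real"
  assumes "\<And>x. 0 \<le> f x" "\<And>x. f x \<le> 1"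
  shows "(\<integral>\<^sup>+x. f x \<partial>measure_pmf M) = ennreal (measure_pmf.expectation M f)"
  using assms by (intro nn_integral_eq_integral integrable_measure_pmf_unit) auto

lemma expectation_bind_pmf_unit:
  fixes f :: "'b \<Rightarrow> real"
  assumes f: "\<And>x. 0 \<le> f x" "\<And>x. f x \<le> 1"
  shows "measure_pmf.expectation (bind_pmf M N) f =
         measure_pmf.expectation M (\<lambda>x. measure_pmf.expectation (N x) f)"
proof -
  have "ennreal (measure_pmf.expectation (bind_pmf M N) f) = (\<integral>\<^sup>+x. f x \<partial>bind_pmf M N)"
    by (rule nn_integral_eq_expectation_unit[OF f, symmetric])
  also have "\<dots> = (\<integral>\<^sup>+x. ennreal (measure_pmf.expectation (N x) f) \<partial>M)"
    unfolding nn_integral_bind_pmf by (simp only: nn_integral_eq_expectation_unit[OF f])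
  also have "\<dots> = ennreal (measure_pmf.expectation M (\<lambda>x. measure_pmf.expectation (N x) f))"
    by (intro nn_integral_eq_expectation_unit expectation_unit f)
  finally show ?thesis
    by (subst (asm) ennreal_inj) (intro expectation_unit f)+
qed

text \<open>The precision is chosen for the final estimate: \<open>36 * (173 / 250)\<close> exceeds
  \<open>20.86 + 4\<close>.\<close>

lemma ln_2_ge: "173 / 250 \<le> ln (2 :: real)"
  using ln_approx_bounds[of 2 3] by (simp add: eval_nat_numeral)

section \<open>The lower tail of vertex degrees\<close>

lemma edges_at_eq:
  assumes "v < n"
  shows "{e \<in> all_edges n. v \<in> e} = (\<lambda>u. {v, u}) ` ({..<n} - {v})"
  using assms by (auto simp: all_edges_def card_2_iff)

lemma card_edges_at:
  assumes "v < n"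
  shows "card {e \<in> all_edges n. v \<in> e} = n - 1"
proof -
  have "inj_on (\<lambda>u. {v, u}) ({..<n} - {v})" by (auto simp: inj_on_def doubleton_eq_iff)
  thus ?thesis using assms by (simp add: edges_at_eq card_image)
qed

text \<open>Chernoff's method with parameter \<open>1 / 3\<close>: Markov's inequality for
  \<open>exp ((d - degree) / 3)\<close>. Each of the \<open>n - 1\<close> possible edges at
  \<open>v\<close> contributes the factor \<open>1 - p * (1 - exp (-1/3))\<close>, which is at most
  \<open>exp (- 5 / 18 * p)\<close> because \<open>exp (-1/3) \<le> 13 / 18\<close>.\<close>

lemma degree_gnp_lower_tail:
  assumes p: "0 \<le> p" "p \<le> 1" and v: "v < n"
  shows "measure_pmf.prob (gnp n p) {E. real (card {u. u \<noteq> v \<and> {v, u} \<in> E}) < d}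
    \<le> exp (d / 3 - 5 / 18 * p * (real n - 1))"
proof -
  let ?A = "all_edges n"
  let ?P = "Pi_pmf ?A False (\<lambda>_. bernoulli_pmf p)"
  let ?f = "\<lambda>present. {e \<in> ?A. present e}"
  let ?S = "{E. real (card {u. u \<noteq> v \<and> {v, u} \<in> E}) < d}"
  \<comment> \<open>Edges away from \<open>v\<close> get the factor 1, so that the product ranges
    over all independent coordinates of \<open>Pi_pmf\<close>.\<close>
  define F where "F e b = (if v \<in> e \<and> b then exp (-1/3) else 1 :: real)" for e :: "nat set" and b
  have prod_F: "(\<Prod>e\<in>?A. F e (y e)) = exp (- real (card {e \<in> ?A. v \<in> e \<and> y e}) / 3)" for y
  proof -
    have "(\<Prod>e\<in>?A. F e (y e)) = (\<Prod>e\<in>{e \<in> ?A. v \<in> e \<and> y e}. exp (-1/3))"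
      using finite_all_edges by (intro prod.mono_neutral_cong_right) (auto simp: F_def)
    also have "\<dots> = exp (- real (card {e \<in> ?A. v \<in> e \<and> y e}) / 3)"
      using exp_of_nat_mult[of "card {e \<in> ?A. v \<in> e \<and> y e}" "-1/3 :: real"] by simp
    finally show ?thesis .
  qed
  have markov: "indicator (?f -` ?S) y \<le> exp (d / 3) * (\<Prod>e\<in>?A. F e (y e))" for y
  proof (cases "y \<in> ?f -` ?S")
    case True
    let ?D = "{u. u \<noteq> v \<and> {v, u} \<in> ?f y}"
    have "finite ?D" by (rule finite_subset[of _ "{..<n}"]) (auto simp: pair_in_all_edges)
    moreover have "{e \<in> ?A. v \<in> e \<and> y e} \<subseteq> (\<lambda>u. {v, u}) ` ?D"
    proof
      fix e assume e: "e \<in> {e \<in> ?A. v \<in> e \<and> y e}"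
      hence "e \<in> (\<lambda>u. {v, u}) ` ({..<n} - {v})" using edges_at_eq[OF v] by blast
      thus "e \<in> (\<lambda>u. {v, u}) ` ?D" using e by auto
    qed
    ultimately have "card {e \<in> ?A. v \<in> e \<and> y e} \<le> card ?D" by (rule surj_card_le)
    hence "real (card {e \<in> ?A. v \<in> e \<and> y e}) < d" using True by auto
    hence "0 \<le> d / 3 + - real (card {e \<in> ?A. v \<in> e \<and> y e}) / 3" by simp
    thus ?thesis using True unfolding prod_F exp_add[symmetric] by simp
  next
    case False
    thus ?thesis by (simp add: prod_nonneg F_def)
  qed
  have q: "exp (-1/3) \<le> (13 / 18 :: real)"
  proof -
    have "(18 / 13 :: real) \<le> 1 + 1/3 + (1/3)\<^sup>2 / 2" by (simp add: power2_eq_square)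
    also have "\<dots> \<le> exp (1/3)" by (rule exp_lower_Taylor_quadratic) simp
    finally have "inverse (exp (1/3)) \<le> inverse (18 / 13 :: real)" by (rule le_imp_inverse_le) simp
    thus ?thesis by (simp add: exp_minus)
  qed
  have "measure_pmf.prob (gnp n p) ?S = measure_pmf.prob ?P (?f -` ?S)"
    by (simp add: gnp_def)
  also have "\<dots> = measure_pmf.expectation ?P (indicator (?f -` ?S))" by simp
  also have "\<dots> \<le> measure_pmf.expectation ?P (\<lambda>y. exp (d / 3) * (\<Prod>e\<in>?A. F e (y e)))"
  proof (rule integral_mono[OF _ _ markov])
    have "integrable (measure_pmf ?P) (\<lambda>y. \<Prod>e\<in>?A. F e (y e))"
      by (rule integrable_measure_pmf_unit) (auto simp: F_def intro!: prod_nonneg prod_le_1)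
    thus "integrable (measure_pmf ?P) (\<lambda>y. exp (d / 3) * (\<Prod>e\<in>?A. F e (y e)))" by simp
  qed (rule integrable_measure_pmf_unit, auto)
  also have "\<dots> = exp (d / 3) * (\<Prod>e\<in>?A. measure_pmf.expectation (bernoulli_pmf p) (F e))"
  proof -
    have "measure_pmf.expectation ?P (\<lambda>y. \<Prod>e\<in>?A. F e (y e)) = (\<Prod>e\<in>?A. measure_pmf.expectation (bernoulli_pmf p) (F e))"
      by (rule expectation_prod_Pi_pmf) (auto simp: finite_all_edges F_def intro!: integrable_measure_pmf_unit)
    thus ?thesis by simp
  qed
  also have "(\<Prod>e\<in>?A. measure_pmf.expectation (bernoulli_pmf p) (F e)) =
      (\<Prod>e\<in>{e \<in> ?A. v \<in> e}. p * exp (-1/3) + (1 - p))"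
    using finite_all_edges p by (intro prod.mono_neutral_cong_right) (auto simp: F_def)
  also have "\<dots> = (p * exp (-1/3) + (1 - p)) ^ (n - 1)" using card_edges_at[OF v] by simp
  also have "\<dots> \<le> exp (- (5 / 18) * p) ^ (n - 1)"
  proof (rule power_mono)
    have "p * exp (-1/3) \<le> p * (13 / 18)" using q p by (intro mult_left_mono)
    thus "p * exp (-1/3) + (1 - p) \<le> exp (- (5 / 18) * p)"
      using exp_ge_add_one_self[of "- (5 / 18) * p"] by linarith
  qed (use p in auto)
  also have "\<dots> = exp (- (5 / 18) * p * (real n - 1))"
    using v by (simp add: exp_of_nat_mult[symmetric] of_nat_diff mult_ac)
  also have "exp (d / 3) * \<dots> = exp (d / 3 - 5 / 18 * p * (real n - 1))"
    by (simp add: exp_add[symmetric])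
  finally show ?thesis by simp
qed

section \<open>Histories of the rotation algorithm\<close>

lemma takeWhile_neq_split:
  assumes "x \<notin> set xs"
  shows "takeWhile (\<lambda>w. w \<noteq> x) (xs @ x # ys) = xs"
proof -
  have "takeWhile (\<lambda>w. w \<noteq> x) (xs @ x # ys) = xs @ takeWhile (\<lambda>w. w \<noteq> x) (x # ys)"
    by (rule takeWhile_append2) (use assms in auto)
  thus ?thesis by simp
qed

lemma path_index_split:
  assumes "x \<notin> set xs"
  shows "path_index (xs @ x # ys) x = Suc (length xs)"
  using takeWhile_neq_split[OF assms] by (simp add: path_index_def)

lemma rotate_path_split:
  assumes "x \<notin> set xs"
  shows "rotate_path (path_index (xs @ x # ys) x) (xs @ x # ys) = xs @ x # rev ys"
  using path_index_split[OF assms] by (simp add: rotate_path_def)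

lemma path_index_eq_1_iff:
  assumes "x \<in> set vs"
  shows "path_index vs x = 1 \<longleftrightarrow> x = hd vs"
  using assms by (cases vs) (auto simp: path_index_def)

text \<open>
  A run is recorded by the list \<open>h\<close> of the vertices picked so far, the latest one first; \<open>h\<close>
  determines the path and the set of used edges without reference to the graph.
\<close>

locale rotation_walk =
  fixes n s :: nat
  assumes s_less: "s < n"
begin

primrec path :: "nat list \<Rightarrow> nat list" where
  "path [] = [s]"
| "path (u # h) = (if u \<in> set (path h) then rotate_path (path_index (path h) u) (path h)
     else path h @ [u])"

definition head :: "nat list \<Rightarrow> nat" where
  "head h = last (path h)"

primrec used :: "nat list \<Rightarrow> nat set set" where
  "used [] = {}"
| "used (u # h) = insert {head h, u} (used h)"

definition unused :: "nat set set \<Rightarrow> nat list \<Rightarrow> nat \<Rightarrow> nat set" where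
  "unused E h v = {u. u \<noteq> v \<and> {v, u} \<in> E - used h}"

text \<open>The targets that the history alone leaves open to the head, whatever the graph
  is.\<close>

definition cand :: "nat list \<Rightarrow> nat set" where
  "cand h = {u. u < n \<and> u \<noteq> head h \<and> {head h, u} \<notin> used h}"

primrec heads :: "nat list \<Rightarrow> nat \<Rightarrow> nat" where
  "heads [] v = 0"
| "heads (u # h) v = heads h v + of_bool (v = head h)"

text \<open>
  The number of used edges at \<open>v\<close>, where the edge that the current head is about to use is
  already counted. With this convention the growth of \<open>uses\<close> depends only on the picked vertex.
\<close>

primrec uses :: "nat list \<Rightarrow> nat \<Rightarrow> nat" where
  "uses [] v = of_bool (v = s)"
| "uses (u # h) v = uses h v + of_bool (v = u) + of_bool (v = head (u # h))"

section \<open>Rotations and the position of the head\<close>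

lemma path_split:
  assumes "u \<in> set (path h)" "distinct (path h)"
  obtains xs ys where "path h = xs @ u # ys" "u \<notin> set xs" "u \<notin> set ys"
    "path (u # h) = xs @ u # rev ys"
proof -
  from split_list[OF assms(1)] obtain xs ys where *: "path h = xs @ u # ys" by blast
  with assms(2) have "u \<notin> set xs" "u \<notin> set ys" by auto
  moreover from this have "path (u # h) = xs @ u # rev ys"
    using rotate_path_split[of u xs ys] * by simp
  ultimately show ?thesis using that * by blast
qed

lemma path_invariant:
  assumes "set h \<subseteq> {..<n}"
  shows "path h \<noteq> [] \<and> distinct (path h) \<and> set (path h) \<subseteq> {..<n} \<and> hd (path h) = s"
  using assms
proof (induction h)
  case Nil
  then show ?case using s_less by simp
next
  case (Cons u h)
  hence IH: "path h \<noteq> []" "distinct (path h)" "set (path h) \<subseteq> {..<n}" "hd (path h) = s" and u: "u < n"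
    by auto
  show ?case
  proof (cases "u \<in> set (path h)")
    case True
    from path_split[OF True IH(2)] obtain xs ys where *: "path h = xs @ u # ys"
      "path (u # h) = xs @ u # rev ys" by blast
    have "hd (path (u # h)) = hd (path h)" unfolding * by (cases xs) auto
    then show ?thesis using IH * by auto
  next
    case False
    then show ?thesis using IH u by auto
  qed
qed

lemmas path_nonempty = path_invariant[THEN conjunct1]
  and distinct_path = path_invariant[THEN conjunct2, THEN conjunct1]
  and set_path = path_invariant[THEN conjunct2, THEN conjunct2, THEN conjunct1]
  and hd_path = path_invariant[THEN conjunct2, THEN conjunct2, THEN conjunct2]

lemma head_in_path: "set h \<subseteq> {..<n} \<Longrightarrow> head h \<in> set (path h)"
  using path_nonempty by (simp add: head_def)

lemma head_less: "set h \<subseteq> {..<n} \<Longrightarrow> head h < n"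
  using head_in_path set_path by blast

lemma start_in_path: "set h \<subseteq> {..<n} \<Longrightarrow> s \<in> set (path h)"
  using path_nonempty hd_path by (metis hd_in_set)

lemma length_path: "set h \<subseteq> {..<n} \<Longrightarrow> length (path h) = card (set (path h))"
  using distinct_path by (simp add: distinct_card)

lemma path_full_iff:
  assumes "set h \<subseteq> {..<n}"
  shows "length (path h) = n \<longleftrightarrow> set (path h) = {..<n}"
  using assms length_path[OF assms] set_path[OF assms]
  by (metis card_lessThan card_subset_eq finite_lessThan)

lemma set_path_Cons:
  assumes "set h \<subseteq> {..<n}"
  shows "set (path (u # h)) = insert u (set (path h))"
proof (cases "u \<in> set (path h)")
  case True
  from path_split[OF True distinct_path[OF assms]] obtain xs ys where *: "path h = xs @ u # ys"
      "path (u # h) = xs @ u # rev ys" by metis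
  show ?thesis unfolding * by auto
qed auto

lemma head_extension: "u \<notin> set (path h) \<Longrightarrow> head (u # h) = u"
  by (simp add: head_def)

text \<open>Reversing the part of the path after \<open>u\<close> puts its first vertex, the old
  successor of \<open>u\<close>, at the end.\<close>

lemma head_rotation:
  assumes "set h \<subseteq> {..<n}" "u \<in> set (path h)" "u \<noteq> head h"
  obtains xs ys where "path h = xs @ u # head (u # h) # ys"
proof -
  from path_split[OF assms(2) distinct_path[OF assms(1)]] obtain xs ys where *: "path h = xs @ u # ys"
      "path (u # h) = xs @ u # rev ys" by metis
  with assms(3) have "ys \<noteq> []" by (auto simp: head_def)
  then obtain y zs where ys: "ys = y # zs" by (cases ys) auto
  have "head (u # h) = y" unfolding head_def *(2) ys by simp
  with * ys that show ?thesis by blast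
qed

text \<open>The new head is the old successor of the picked vertex, and a vertex has at most one
  predecessor on a path.\<close>

lemma inj_on_head_rotation:
  assumes "set h \<subseteq> {..<n}"
  shows "inj_on (\<lambda>u. head (u # h)) (set (path h) - {head h})"
proof (rule inj_onI)
  fix u u' assume u: "u \<in> set (path h) - {head h}" "u' \<in> set (path h) - {head h}"
    and eq: "head (u # h) = head (u' # h)"
  from u head_rotation[OF assms, of u] obtain xs ys where 1: "path h = xs @ u # head (u # h) # ys" by auto
  from u head_rotation[OF assms, of u'] obtain xs' ys' where 2: "path h = xs' @ u' # head (u # h) # ys'"
    unfolding eq by auto
  define y where "y = head (u # h)"
  have d: "distinct ((xs @ [u]) @ y # ys)" using distinct_path[OF assms] 1 by (simp add: y_def)
  have "(xs @ [u]) @ y # ys = (xs' @ [u']) @ y # ys'" using 1 2 by (simp add: y_def)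
  with d have "xs @ [u] = xs' @ [u']"
    by (metis append_eq_append_conv_if distinct_append append_Cons_eq_iff[of y "xs @ [u]" ys "xs' @ [u']" ys']
        distinct.simps(2) not_distinct_conv_prefix)
  thus "u = u'" by simp
qed

lemma head_rotation_neq:
  assumes "set h \<subseteq> {..<n}" "u \<in> set (path h)" "u \<noteq> head h"
  shows "head (u # h) \<noteq> u"
  using head_rotation[OF assms] distinct_path[OF assms(1)]
  by (metis distinct.simps(2) distinct_append list.set_intros(1))

section \<open>Counting used edges and open targets\<close>

lemma finite_used: "finite (used h)"
  by (induction h) auto

text \<open>The head term makes the induction work: the edge that a pick adds at the old head was
  counted when that vertex became the head, so only its other end has to be charged now.\<close>

lemma card_used_at_le_uses:
  "card {e \<in> used h. v \<in> e} + of_bool (v = head h) \<le> uses h v"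
proof (induction h)
  case Nil
  then show ?case by (simp add: head_def)
next
  case (Cons u h)
  have "card {e \<in> used (u # h). v \<in> e} \<le> card {e \<in> used h. v \<in> e} + of_bool (v \<in> {head h, u})"
  proof (cases "v \<in> {head h, u}")
    case True
    hence "{e \<in> used (u # h). v \<in> e} = insert {head h, u} {e \<in> used h. v \<in> e}" by auto
    thus ?thesis using True finite_used[of h] by (simp add: card_insert_if)
  next
    case False
    hence "{e \<in> used (u # h). v \<in> e} = {e \<in> used h. v \<in> e}" by auto
    thus ?thesis by simp
  qed
  also have "\<dots> \<le> card {e \<in> used h. v \<in> e} + of_bool (v = head h) + of_bool (v = u)" by auto
  also have "\<dots> \<le> uses h v + of_bool (v = u)" using Cons.IH by simp
  finally show ?case by simp
qed

lemma card_neighbours_le: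
  assumes "finite S"
  shows "card {u. {v, u} \<in> S} \<le> card {e \<in> S. v \<in> e}"
  by (rule card_inj_on_le[of "\<lambda>u. {v, u}"]) (use assms in \<open>auto simp: inj_on_def doubleton_eq_iff\<close>)

lemma finite_neighbours:
  assumes "finite S"
  shows "finite {u. {v, u} \<in> S}"
proof -
  have "finite ((\<lambda>u. {v, u}) -` S)"
    by (rule finite_vimageI) (use assms in \<open>auto simp: inj_on_def doubleton_eq_iff\<close>)
  thus ?thesis by (simp add: vimage_def)
qed

lemma card_used_neighbours_le: "card {u. {v, u} \<in> used h} \<le> uses h v"
  using card_neighbours_le[OF finite_used] card_used_at_le_uses[of h v] by (metis add_leD1 le_trans)

lemma sum_heads:
  assumes "set h \<subseteq> {..<n}"
  shows "(\<Sum>v<n. heads h v) = length h"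
  using assms
proof (induction h)
  case (Cons u h)
  then show ?case using head_less[of h] by (simp add: sum.distrib of_bool_def)
qed auto

lemma finite_cand: "finite (cand h)"
  by (rule finite_subset[of _ "{..<n}"]) (auto simp: cand_def)

lemma card_cand_le:
  assumes "set h \<subseteq> {..<n}"
  shows "card (cand h) \<le> n - 1"
proof -
  have "card (cand h) \<le> card ({..<n} - {head h})"
    by (rule card_mono) (auto simp: cand_def)
  thus ?thesis using head_less[OF assms] by simp
qed

lemma card_cand_ge: "n \<le> card (cand h) + 1 + uses h (head h)"
proof -
  have "{..<n} \<subseteq> cand h \<union> {head h} \<union> {u. {head h, u} \<in> used h}" by (auto simp: cand_def)
  hence "card {..<n} \<le> card (cand h \<union> {head h} \<union> {u. {head h, u} \<in> used h})"
    by (rule card_mono[rotated]) (use finite_cand finite_neighbours[OF finite_used] in auto)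
  also have "\<dots> \<le> card (cand h) + card {head h} + card {u. {head h, u} \<in> used h}"
    by (meson card_Un_le add_mono le_refl order_trans)
  finally show ?thesis using card_used_neighbours_le[of "head h" h] by simp
qed

lemma used_subset_path:
  assumes "set h \<subseteq> {..<n}"
  shows "\<Union> (used h) \<subseteq> set (path h)"
  using assms
proof (induction h)
  case (Cons u h)
  hence "set h \<subseteq> {..<n}" by simp
  from set_path_Cons[OF this] head_in_path[OF this] Cons show ?case by auto
qed auto

lemma off_path_in_cand:
  assumes "set h \<subseteq> {..<n}" "u < n" "u \<notin> set (path h)"
  shows "u \<in> cand h"
  using assms used_subset_path[OF assms(1)] head_in_path[OF assms(1)] by (auto simp: cand_def)

lemma heads_off_path:
  assumes "set h \<subseteq> {..<n}" "u \<notin> set (path h)"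
  shows "heads h u = 0"
  using assms
proof (induction h)
  case (Cons w h)
  hence "set h \<subseteq> {..<n}" by simp
  from set_path_Cons[OF this] head_in_path[OF this] Cons show ?case by auto
qed auto

lemma remove_edge_unused:
  assumes "u \<noteq> head h"
  shows "remove_edge (head h) u (unused E h) = unused E (u # h)"
  using assms by (auto simp: fun_eq_iff remove_edge_def unused_def doubleton_eq_iff)

lemma finite_unused: "E \<subseteq> all_edges n \<Longrightarrow> finite (unused E h v)"
  by (rule finite_subset[of _ "{..<n}"]) (auto simp: unused_def dest!: subsetD simp: pair_in_all_edges)

lemma unused_head_subset_cand: "E \<subseteq> all_edges n \<Longrightarrow> unused E h (head h) \<subseteq> cand h"
  by (auto simp: unused_def cand_def dest!: subsetD simp: pair_in_all_edges)

lemma head_neq_start: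
  assumes "set h \<subseteq> {..<n}" "2 \<le> length (path h)"
  shows "head h \<noteq> s"
proof -
  obtain x y zs where p: "path h = x # y # zs"
    using assms(2) by (metis Suc_le_length_iff numeral_2_eq_2)
  hence "x = s" using hd_path[OF assms(1)] by simp
  moreover have "last (y # zs) \<in> set (y # zs)" by (rule last_in_set) simp
  ultimately show ?thesis using p distinct_path[OF assms(1)] by (auto simp: head_def)
qed

lemma length_path_Cons:
  assumes "set h \<subseteq> {..<n}" "u < n"
  shows "length (path (u # h)) = length (path h) + of_bool (u \<notin> set (path h))"
  using assms length_path[of h] length_path[of "u # h"] set_path_Cons[of h u] by (simp add: card_insert_if)

lemma uses_off_path:
  assumes "set h \<subseteq> {..<n}" "v \<notin> set (path h)"
  shows "uses h v = 0"
  using assms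
proof (induction h)
  case (Cons u h)
  hence "set h \<subseteq> {..<n}" by simp
  from set_path_Cons[OF this] head_in_path[OF Cons.prems(1)] Cons show ?case by auto
qed auto

text \<open>The picks that keep the walk running; with a complete path, picking \<open>s\<close>
  closes the cycle and ends it.\<close>

definition moves :: "nat list \<Rightarrow> nat set" where
  "moves h = {u \<in> cand h. \<not> (length (path h) = n \<and> u = s)}"

lemma finite_moves: "finite (moves h)"
  using finite_cand by (simp add: moves_def)

text \<open>The bridge to the algorithm: states of a run can be replaced by the histories that
  produce them.\<close>

lemma dra_move_eq:
  assumes "set h \<subseteq> {..<n}" "u \<in> cand h"
  shows "dra_move n (unused E h) (path h) u =
    (if length (path h) = n \<and> u = s then Success (path h) else Running (unused E (u # h)) (path (u # h)))"
proof -
  have "u \<noteq> head h" using assms by (simp add: cand_def)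
  note rem = remove_edge_unused[OF this, of E, unfolded head_def]
  show ?thesis
  proof (cases "u \<in> set (path h)")
    case True
    then show ?thesis
      using rem path_index_eq_1_iff[OF True] hd_path[OF assms(1)] by (simp add: dra_move_def Let_def)
  next
    case False
    then show ?thesis using rem start_in_path[OF assms(1)] by (auto simp: dra_move_def Let_def)
  qed
qed

end

section \<open>Weights of histories\<close>

locale killed_walk = rotation_walk +
  fixes p K :: real
  assumes p_nonneg: "0 \<le> p" and p_le_1: "p \<le> 1" and K_pos: "0 < K"
begin

text \<open>
  The probability of following \<open>h\<close> on the graph \<open>E\<close>, for a walk that picks each unused edge at the
  head with probability \<open>1 / max d K\<close>, where \<open>d\<close> is the number of unused edges, and dies otherwise.
  It is the rotation algorithm itself as long as no head has fewer than \<open>K\<close> unused edges.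
\<close>

primrec weight :: "nat set set \<Rightarrow> nat list \<Rightarrow> real" where
  "weight E [] = 1"
| "weight E (u # h) = weight E h *
     (if u \<in> unused E h (head h) then 1 / max (real (card (unused E h (head h)))) K else 0)"

definition mass :: "nat list \<Rightarrow> real" where
  "mass h = (\<Sum>E\<in>Pow (all_edges n). pmf (gnp n p) E * weight E h)"

lemma weight_nonneg: "0 \<le> weight E h"
  using K_pos by (induction h) auto

lemma mass_nonneg: "0 \<le> mass h"
  unfolding mass_def by (intro sum_nonneg mult_nonneg_nonneg weight_nonneg) auto

lemma mass_Nil: "mass [] = 1"
  using sum_pmf_eq_1[OF _ set_pmf_gnp, of n p] by (simp add: mass_def finite_all_edges)

lemma mass_not_cand:
  assumes "u \<notin> cand h"
  shows "mass (u # h) = 0"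
  unfolding mass_def
proof (rule sum.neutral, rule ballI)
  fix E assume "E \<in> Pow (all_edges n)"
  hence "u \<notin> unused E h (head h)" using assms unused_head_subset_cand[of E h] by blast
  thus "pmf (gnp n p) E * weight E (u # h) = 0" by simp
qed

text \<open>The gap between the two sides is the probability of following \<open>h\<close> and then
  dying.\<close>

lemma sum_weight_Cons_le:
  assumes "E \<subseteq> all_edges n"
  shows "(\<Sum>u\<in>cand h. weight E (u # h)) \<le> weight E h"
proof -
  let ?U = "unused E h (head h)"
  have "(\<Sum>u\<in>cand h. if u \<in> ?U then 1 / max (real (card ?U)) K else 0) = (\<Sum>u\<in>?U. 1 / max (real (card ?U)) K)"
    using unused_head_subset_cand[OF assms] by (intro sum.mono_neutral_cong_right finite_cand) auto
  also have "\<dots> \<le> 1" using K_pos by (simp add: divide_le_eq max_def)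
  finally have "weight E h * (\<Sum>u\<in>cand h. if u \<in> ?U then 1 / max (real (card ?U)) K else 0) \<le> weight E h"
    by (rule mult_left_le) (rule weight_nonneg)
  thus ?thesis by (simp add: sum_distrib_left)
qed

lemma sum_mass_Cons_le: "(\<Sum>u\<in>cand h. mass (u # h)) \<le> mass h"
proof -
  have "(\<Sum>u\<in>cand h. mass (u # h)) = (\<Sum>E\<in>Pow (all_edges n). pmf (gnp n p) E * (\<Sum>u\<in>cand h. weight E (u # h)))"
    unfolding mass_def by (subst sum.swap) (simp add: sum_distrib_left del: weight.simps)
  also have "\<dots> \<le> mass h"
    unfolding mass_def by (intro sum_mono mult_left_mono sum_weight_Cons_le) auto
  finally show ?thesis .
qed

lemma card_unused_transpose:
  assumes "E \<subseteq> all_edges n" "v < n" "u < n" "u' < n" "v \<noteq> u" "v \<noteq> u'" "u \<noteq> u'"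
    and "{v, u} \<notin> used h" "{v, u'} \<notin> used h" "{v, u'} \<in> E"
  shows "card (unused E h y) \<le> card (unused (Transposition.transpose {v, u} {v, u'} ` E) h y) + of_bool (y = u')"
proof -
  define E' where "E' = Transposition.transpose {v, u} {v, u'} ` E"
  have E'_iff: "e \<in> E' \<longleftrightarrow> (if e = {v, u} then {v, u'} \<in> E else if e = {v, u'} then {v, u} \<in> E else e \<in> E)" for e
    unfolding E'_def in_transpose_image_iff by (simp add: Transposition.transpose_def)
  have "E' \<subseteq> all_edges n"
    unfolding E'_def using assms by (intro transpose_image_subset) (auto simp: pair_in_all_edges)
  from finite_unused[OF this] have fin: "finite (unused E' h y)" .
  consider "y = v" | "y = u'" | "y \<noteq> v" "y \<noteq> u'" by blast
  thus ?thesis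
  proof cases
    case 1
    have "x \<in> unused E h v \<longleftrightarrow> Transposition.transpose u u' x \<in> unused E' h v" for x
    proof -
      consider "x = u" | "x = u'" | "x \<noteq> u" "x \<noteq> u'" by blast
      thus ?thesis
        by cases (use assms in \<open>simp_all add: unused_def E'_iff doubleton_eq_iff Transposition.transpose_def\<close>)
    qed
    hence "unused E h v = Transposition.transpose u u' ` unused E' h v"
      by (simp add: set_eq_iff in_transpose_image_iff)
    thus ?thesis using 1 fin unfolding E'_def[symmetric] by (simp add: card_image_le trans_le_add1)
  next
    case 2
    have "unused E h y \<subseteq> insert v (unused E' h y)"
      using 2 assms by (auto simp: unused_def E'_iff doubleton_eq_iff)
    hence "card (unused E h y) \<le> card (insert v (unused E' h y))" using fin by (intro card_mono) auto
    also have "\<dots> \<le> card (unused E' h y) + 1" using fin by (simp add: card_insert_if)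
    finally show ?thesis using 2 unfolding E'_def[symmetric] by simp
  next
    case 3
    have "unused E h y \<subseteq> unused E' h y"
      using 3 assms by (auto simp: unused_def E'_iff doubleton_eq_iff)
    thus ?thesis using fin unfolding E'_def[symmetric] by (simp add: card_mono trans_le_add1)
  qed
qed

text \<open>Neither exchanged edge has been used, so every pick of \<open>h\<close> stays available.
  Only at times when \<open>u'\<close> is the head can a denominator drop, by at most 1; since
  denominators are kept at or above \<open>K\<close>, this costs a factor of at most
  \<open>1 + 1 / K\<close> each time.\<close>

lemma weight_transpose_le:
  assumes "E \<subseteq> all_edges n" "v < n" "u < n" "u' < n" "v \<noteq> u" "v \<noteq> u'" "u \<noteq> u'"
    and "{v, u} \<notin> used h" "{v, u'} \<notin> used h" "{v, u'} \<in> E"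
  shows "weight (Transposition.transpose {v, u} {v, u'} ` E) h \<le> (1 + 1 / K) ^ heads h u' * weight E h"
  using assms(8,9)
proof (induction h)
  case (Cons x h)
  define E' where "E' = Transposition.transpose {v, u} {v, u'} ` E"
  note IH = Cons.IH[folded E'_def]
  let ?y = "head h"
  have nu: "{v, u} \<notin> used h" "{v, u'} \<notin> used h" "{?y, x} \<noteq> {v, u}" "{?y, x} \<noteq> {v, u'}"
    using Cons.prems by auto
  have iff: "x \<in> unused E' h ?y \<longleftrightarrow> x \<in> unused E h ?y"
    using transpose_apply_other[OF nu(3,4)] by (simp add: unused_def E'_def in_transpose_image_iff)
  let ?c = "real (card (unused E h ?y))" and ?c' = "real (card (unused E' h ?y))"
  have "?c \<le> ?c' + of_bool (?y = u')"
    using card_unused_transpose[OF assms(1-7) nu(1,2) assms(10), of ?y] unfolding E'_def[symmetric]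
    by (metis of_nat_add of_nat_le_iff of_nat_of_bool)
  hence "max ?c K \<le> max ?c' K + of_bool (?y = u')" by (auto simp: max_def)
  also have "\<dots> \<le> (1 + 1 / K) ^ of_bool (u' = ?y) * max ?c' K"
  proof (cases "u' = ?y")
    case True
    have "1 \<le> max ?c' K / K" using K_pos by simp
    thus ?thesis using True by (simp add: distrib_right)
  qed auto
  finally have *: "max ?c K \<le> (1 + 1 / K) ^ of_bool (u' = ?y) * max ?c' K" .
  have "0 < max ?c K" "0 < max ?c' K" using K_pos by auto
  with * have "1 / max ?c' K \<le> (1 + 1 / K) ^ of_bool (u' = ?y) * (1 / max ?c K)"
    by (simp only: times_divide_eq_right mult_1_right pos_divide_le_eq pos_le_divide_eq times_divide_eq_left mult_1_left)
  hence "weight E' h * (1 / max ?c' K) \<le>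
         ((1 + 1 / K) ^ heads h u' * weight E h) * ((1 + 1 / K) ^ of_bool (u' = ?y) * (1 / max ?c K))"
    using IH[OF nu(1,2)] K_pos weight_nonneg by (intro mult_mono mult_nonneg_nonneg) auto
  thus ?case
    unfolding E'_def[symmetric] using iff by (simp add: power_add mult_ac)
qed simp

text \<open>
  Exchanging the edges from the head to \<open>u\<close> and to \<open>u'\<close> preserves the law of the graph; it only
  changes the degrees of \<open>u\<close> and \<open>u'\<close>, and by one.
\<close>

lemma mass_Cons_le_mass_Cons:
  assumes h: "set h \<subseteq> {..<n}" and "u \<in> cand h" "u' \<in> cand h"
  shows "mass (u # h) \<le> (1 + 1 / K) ^ heads h u' * mass (u' # h)"
proof (cases "u = u'")
  case True
  have "1 * mass (u # h) \<le> (1 + 1 / K) ^ heads h u' * mass (u # h)"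
    by (intro mult_right_mono mass_nonneg one_le_power) (use K_pos in auto)
  thus ?thesis using True by simp
next
  case False
  define v where "v = head h"
  have v: "v < n" using head_less[OF h] by (simp add: v_def)
  have u: "u < n" "u' < n" "v \<noteq> u" "v \<noteq> u'" "{v, u} \<notin> used h" "{v, u'} \<notin> used h"
    using assms by (auto simp: cand_def v_def)
  let ?t = "\<lambda>E. Transposition.transpose {v, u} {v, u'} ` E"
  have e: "{v, u} \<in> all_edges n" "{v, u'} \<in> all_edges n" using u v by (auto simp: pair_in_all_edges)
  have inv: "?t (?t E) = E" for E by (simp add: image_image)
  have bij: "bij_betw ?t (Pow (all_edges n)) (Pow (all_edges n))"
    by (rule bij_betwI[where g = ?t]) (simp_all add: inv transpose_image_subset[OF e])
  have le: "weight (?t E) (u # h) \<le> (1 + 1 / K) ^ heads h u' * weight E (u' # h)"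
    if E: "E \<subseteq> all_edges n" for E
  proof (cases "{v, u'} \<in> E")
    case True
    have tu': "u' \<in> unused E h v" using True u by (auto simp: unused_def)
    have tu: "u \<in> unused (?t E) h v" using True u by (auto simp: unused_def in_transpose_image_iff)
    have "card (unused E h v) \<le> card (unused (?t E) h v)"
      using card_unused_transpose[OF E v u(1-4) False u(5,6) True, of v] u by simp
    hence "1 / max (real (card (unused (?t E) h v))) K \<le> 1 / max (real (card (unused E h v))) K"
      using K_pos by (intro divide_left_mono) auto
    hence "weight (?t E) h * (1 / max (real (card (unused (?t E) h v))) K) \<le>
      ((1 + 1 / K) ^ heads h u' * weight E h) * (1 / max (real (card (unused E h v))) K)"
      using weight_transpose_le[OF E v u(1-4) False u(5,6) True] K_pos weight_nonneg
      by (intro mult_mono mult_nonneg_nonneg) auto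
    thus ?thesis using tu tu' by (simp add: v_def mult.assoc)
  next
    case False
    \<comment> \<open>Without \<open>{v, u'}\<close> the exchanged graph lacks
      \<open>{v, u}\<close>, so \<open>u\<close> cannot be picked there.\<close>
    hence "u \<notin> unused (?t E) h v" by (auto simp: unused_def in_transpose_image_iff)
    hence "weight (?t E) (u # h) = 0" by (simp add: v_def)
    thus ?thesis using weight_nonneg[of E "u' # h"] K_pos by (simp del: weight.simps)
  qed
  have "mass (u # h) = (\<Sum>E\<in>Pow (all_edges n). pmf (gnp n p) (?t E) * weight (?t E) (u # h))"
    unfolding mass_def using sum.reindex_bij_betw[OF bij, of "\<lambda>E. pmf (gnp n p) E * weight E (u # h)"] by simp
  also have "\<dots> = (\<Sum>E\<in>Pow (all_edges n). pmf (gnp n p) E * weight (?t E) (u # h))"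
    using e by (intro sum.cong) (auto simp: pmf_gnp_transpose simp del: weight.simps)
  also have "\<dots> \<le> (\<Sum>E\<in>Pow (all_edges n). pmf (gnp n p) E * ((1 + 1 / K) ^ heads h u' * weight E (u' # h)))"
    by (intro sum_mono mult_left_mono le) auto
  also have "\<dots> = (1 + 1 / K) ^ heads h u' * mass (u' # h)"
    unfolding mass_def by (simp add: sum_distrib_left mult_ac del: weight.simps)
  finally show ?thesis .
qed

text \<open>The exchange inequality is summed over all \<open>u'\<close> in \<open>cand h\<close>.
  The inverse of \<open>(1 + 1 / K) ^ k\<close> is at least \<open>1 - k / K\<close>, and the head
  counts of all vertices add up to the length of \<open>h\<close>, so the total loss is at most
  \<open>length h / K\<close>.\<close>

lemma mass_Cons_le:
  assumes h: "set h \<subseteq> {..<n}" and u: "u \<in> cand h"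
  shows "mass (u # h) * (real n - 1 - uses h (head h) - length h / K) \<le> mass h"
proof -
  have bern: "1 - real k / K \<le> 1 / (1 + 1 / K) ^ k" for k
  proof -
    have "(1 + 1 / K) ^ k \<le> exp (1 / K) ^ k" by (intro power_mono) (use K_pos in auto)
    hence "1 / exp (1 / K) ^ k \<le> 1 / (1 + 1 / K) ^ k"
      by (rule divide_left_mono) (use K_pos in \<open>auto intro!: mult_pos_pos zero_less_power add_pos_pos\<close>)
    moreover have "exp (- (real k / K)) = 1 / exp (1 / K) ^ k"
      using exp_of_nat_mult[of k "1 / K"] by (simp add: exp_minus inverse_eq_divide)
    ultimately have "exp (- (real k / K)) \<le> 1 / (1 + 1 / K) ^ k" by simp
    thus ?thesis using exp_ge_add_one_self[of "- (real k / K)"] by linarith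
  qed
  have "mass (u # h) * (1 - heads h u' / K) \<le> mass (u' # h)" if "u' \<in> cand h" for u'
  proof -
    have "mass (u # h) * (1 - heads h u' / K) \<le> mass (u # h) * (1 / (1 + 1 / K) ^ heads h u')"
      by (intro mult_left_mono bern mass_nonneg)
    also have "\<dots> \<le> mass (u' # h)"
    proof -
      have "0 < (1 + 1 / K) ^ heads h u'" using K_pos by (intro zero_less_power add_pos_pos) auto
      thus ?thesis using mass_Cons_le_mass_Cons[OF h u that]
        by (simp only: times_divide_eq_right mult_1_right pos_divide_le_eq mult.commute)
    qed
    finally show ?thesis .
  qed
  hence "(\<Sum>u'\<in>cand h. mass (u # h) * (1 - heads h u' / K)) \<le> (\<Sum>u'\<in>cand h. mass (u' # h))"
    by (rule sum_mono)
  also have "\<dots> \<le> mass h" by (rule sum_mass_Cons_le)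
  finally have 1: "mass (u # h) * (\<Sum>u'\<in>cand h. 1 - heads h u' / K) \<le> mass h"
    by (simp add: sum_distrib_left)
  have "(\<Sum>u'\<in>cand h. heads h u') \<le> (\<Sum>u'<n. heads h u')"
    by (rule sum_mono2) (auto simp: cand_def)
  hence "(\<Sum>u'\<in>cand h. heads h u') \<le> length h" using sum_heads[OF h] by simp
  hence "(\<Sum>u'\<in>cand h. real (heads h u')) \<le> real (length h)"
    by (metis of_nat_le_iff of_nat_sum)
  hence "(\<Sum>u'\<in>cand h. heads h u' / K) \<le> length h / K"
    unfolding sum_divide_distrib[symmetric] using K_pos by (intro divide_right_mono) auto
  moreover have "real n - 1 - uses h (head h) \<le> card (cand h)"
    using card_cand_ge[of h] by linarith
  ultimately have "real n - 1 - uses h (head h) - length h / K \<le> (\<Sum>u'\<in>cand h. 1 - heads h u' / K)"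
    by (simp add: sum_subtractf)
  from mult_left_mono[OF this mass_nonneg[of "u # h"]] 1 show ?thesis by linarith
qed

text \<open>A positive weight means that every picked edge lies in \<open>E\<close>. A rotation
  reverses a piece of the path, which keeps its undirected edges, and joins it to \<open>u\<close>
  by the picked edge.\<close>

lemma weight_path_edges:
  assumes "set h \<subseteq> {..<n}" "weight E h \<noteq> 0"
  shows "successively (\<lambda>x y. {x, y} \<in> E) (path h)"
  using assms
proof (induction h)
  case (Cons u h)
  hence h: "set h \<subseteq> {..<n}" and IH: "successively (\<lambda>x y. {x, y} \<in> E) (path h)"
    and e: "{head h, u} \<in> E" "u \<noteq> head h"
    by (auto simp: unused_def split: if_splits)
  show ?case
  proof (cases "u \<in> set (path h)")
    case True
    from path_split[OF True distinct_path[OF h]] obtain xs ys where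
      *: "path h = xs @ u # ys" "path (u # h) = xs @ u # rev ys" by metis
    have sym: "(\<lambda>x y. {y, x} \<in> E) = (\<lambda>x y. {x, y} \<in> E)" by (simp add: insert_commute)
    have "ys \<noteq> []" using e *(1) by (auto simp: head_def)
    hence "hd (rev ys) = head h" using *(1) by (simp add: hd_rev head_def)
    thus ?thesis using IH e unfolding *
      by (auto simp: successively_append_iff successively_Cons sym insert_commute)
  next
    case False
    thus ?thesis using IH e path_nonempty[OF h]
      by (auto simp: successively_append_iff head_def)
  qed
qed simp

lemma ham_cycle_path:
  assumes "set h \<subseteq> {..<n}" "weight E h \<noteq> 0" "length (path h) = n" "3 \<le> n" "s \<in> unused E h (head h)"
  shows "ham_cycle n E (path h)"
  using assms weight_path_edges[OF assms(1,2)] distinct_path[OF assms(1)] path_full_iff[OF assms(1)] hd_path[OF assms(1)]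
  by (auto simp: ham_cycle_def successively_conv_nth unused_def head_def)

end

section \<open>Potentials\<close>

locale capped_walk = killed_walk +
  fixes m :: real
  assumes m_ge_1: "1 \<le> m"
begin

primrec good :: "nat list \<Rightarrow> bool" where
  "good [] \<longleftrightarrow> True"
| "good (u # h) \<longleftrightarrow> good h \<and> u \<in> moves h \<and> (\<forall>v. real (uses (u # h) v) \<le> m)"

definition goods :: "nat \<Rightarrow> nat list set" where
  "goods t = {h. length h = t \<and> good h}"

text \<open>Histories at the moment when the cap is first exceeded, including the offending
  pick.\<close>

definition exits :: "nat \<Rightarrow> nat list set" where
  "exits t = {u # h |u h. Suc (length h) = t \<and> good h \<and> u \<in> moves h \<and> \<not> (\<forall>v. real (uses (u # h) v) \<le> m)}"

section \<open>Decomposing histories by their last pick, and iterating potentials\<close>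

lemma good_set: "good h \<Longrightarrow> set h \<subseteq> {..<n}"
  by (induction h) (auto simp: moves_def cand_def)

lemma good_uses: "good h \<Longrightarrow> real (uses h v) \<le> m"
  using m_ge_1 by (cases h) auto

lemma goods_exits_Suc: "goods (Suc t) \<union> exits (Suc t) = (\<lambda>(h, u). u # h) ` Sigma (goods t) moves"
proof (intro equalityI subsetI)
  fix h' assume "h' \<in> goods (Suc t) \<union> exits (Suc t)"
  then obtain u h where "h' = u # h" "(h, u) \<in> Sigma (goods t) moves"
    by (cases h') (auto simp: goods_def exits_def simp del: uses.simps)
  thus "h' \<in> (\<lambda>(h, u). u # h) ` Sigma (goods t) moves" by force
next
  fix h' assume "h' \<in> (\<lambda>(h, u). u # h) ` Sigma (goods t) moves"
  then obtain u h where "h' = u # h" "length h = t" "good h" "u \<in> moves h" by (auto simp: goods_def)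
  thus "h' \<in> goods (Suc t) \<union> exits (Suc t)"
    by (cases "\<forall>v. real (uses (u # h) v) \<le> m") (auto simp: goods_def exits_def simp del: uses.simps)
qed

lemma finite_goods: "finite (goods t)"
proof (rule finite_subset)
  show "goods t \<subseteq> {h. set h \<subseteq> {..<n} \<and> length h = t}" using good_set by (auto simp: goods_def)
qed (simp add: finite_lists_length_eq)

lemma finite_exits: "finite (exits t)"
proof (cases t)
  case (Suc k)
  have "finite (goods (Suc k) \<union> exits (Suc k))"
    unfolding goods_exits_Suc using finite_goods finite_moves by auto
  thus ?thesis using Suc by simp
qed (simp add: exits_def)

lemma goods_0: "goods 0 = {[]}"
  by (auto simp: goods_def)

lemma sum_goods_exits_Suc:
  fixes f :: "nat list \<Rightarrow> real"
  shows "(\<Sum>h\<in>goods (Suc t). f h) + (\<Sum>h\<in>exits (Suc t). f h) = (\<Sum>h\<in>goods t. \<Sum>u\<in>moves h. f (u # h))"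
proof -
  have "goods (Suc t) \<inter> exits (Suc t) = {}" by (auto simp: goods_def exits_def simp del: uses.simps)
  hence "(\<Sum>h\<in>goods (Suc t). f h) + (\<Sum>h\<in>exits (Suc t). f h) = (\<Sum>h\<in>goods (Suc t) \<union> exits (Suc t). f h)"
    using finite_goods finite_exits by (simp add: sum.union_disjoint)
  also have "\<dots> = (\<Sum>(h, u)\<in>Sigma (goods t) moves. f (u # h))"
    unfolding goods_exits_Suc by (subst sum.reindex) (auto simp: inj_on_def case_prod_unfold)
  also have "\<dots> = (\<Sum>h\<in>goods t. \<Sum>u\<in>moves h. f (u # h))"
    by (subst sum.Sigma) (use finite_goods finite_moves in auto)
  finally show ?thesis .
qed

text \<open>A supermartingale bound: one pick multiplies the expected potential by at most
  \<open>c\<close>, and whatever leaves through an exit or a closed cycle is dropped.\<close>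

lemma potential_bound:
  fixes g :: "nat list \<Rightarrow> real"
  assumes "\<And>h. 0 \<le> g h" "0 \<le> c"
    and step: "\<And>h. good h \<Longrightarrow> length h < T \<Longrightarrow> (\<Sum>u\<in>moves h. mass (u # h) * g (u # h)) \<le> c * (mass h * g h)"
    and "t \<le> T"
  shows "(\<Sum>h\<in>goods t. mass h * g h) \<le> c ^ t * g []"
  using assms(4)
proof (induction t)
  case 0
  then show ?case by (simp add: goods_0 mass_Nil)
next
  case (Suc t)
  have "(\<Sum>h\<in>goods (Suc t). mass h * g h) \<le> (\<Sum>h\<in>goods (Suc t). mass h * g h) + (\<Sum>h\<in>exits (Suc t). mass h * g h)"
    using assms(1) mass_nonneg by (simp add: sum_nonneg)
  also have "\<dots> = (\<Sum>h\<in>goods t. \<Sum>u\<in>moves h. mass (u # h) * g (u # h))" by (rule sum_goods_exits_Suc)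
  also have "\<dots> \<le> (\<Sum>h\<in>goods t. c * (mass h * g h))"
    by (intro sum_mono step) (use Suc.prems in \<open>auto simp: goods_def\<close>)
  also have "\<dots> = c * (\<Sum>h\<in>goods t. mass h * g h)" by (simp add: sum_distrib_left)
  also have "\<dots> \<le> c * (c ^ t * g [])" using Suc assms(2) by (intro mult_left_mono) auto
  finally show ?case by (simp add: mult.assoc)
qed

text \<open>Here the exits are kept: as \<open>1 \<le> c\<close>, the part that has left earlier may
  be multiplied by \<open>c\<close> along with the part still running.\<close>

lemma potential_exits_bound:
  fixes g :: "nat list \<Rightarrow> real"
  assumes "\<And>h. 0 \<le> g h" "1 \<le> c"
    and step: "\<And>h. good h \<Longrightarrow> length h < T \<Longrightarrow> (\<Sum>u\<in>moves h. mass (u # h) * g (u # h)) \<le> c * (mass h * g h)"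
    and "t \<le> T"
  shows "(\<Sum>h\<in>goods t. mass h * g h) + (\<Sum>i=1..t. \<Sum>h\<in>exits i. mass h * g h) \<le> c ^ t * g []"
  using assms(4)
proof (induction t)
  case 0
  then show ?case by (simp add: goods_0 mass_Nil)
next
  case (Suc t)
  let ?S = "\<lambda>t. \<Sum>h\<in>goods t. mass h * g h" and ?X = "\<Sum>i=1..t. \<Sum>h\<in>exits i. mass h * g h"
  have "?S (Suc t) + (\<Sum>i=1..Suc t. \<Sum>h\<in>exits i. mass h * g h) =
      (\<Sum>h\<in>goods t. \<Sum>u\<in>moves h. mass (u # h) * g (u # h)) + ?X"
    using sum_goods_exits_Suc[where f = "\<lambda>h. mass h * g h"] by simp
  also have "\<dots> \<le> (\<Sum>h\<in>goods t. c * (mass h * g h)) + ?X"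
    by (intro add_right_mono sum_mono step) (use Suc.prems in \<open>auto simp: goods_def\<close>)
  also have "\<dots> = c * ?S t + 1 * ?X" by (simp add: sum_distrib_left)
  also have "\<dots> \<le> c * ?S t + c * ?X"
    using assms(1,2) mass_nonneg by (intro add_left_mono mult_right_mono sum_nonneg) auto
  also have "\<dots> = c * (?S t + ?X)" by (simp add: distrib_left)
  also have "\<dots> \<le> c * (c ^ t * g [])" using Suc assms(2) by (intro mult_left_mono) auto
  finally show ?case by (simp add: mult.assoc)
qed

text \<open>\<open>r\<close> measures how far a pick may exceed the uniform rate
  \<open>1 / n\<close> up to time \<open>T\<close>; the cap controls the used edges at the head, and
  \<open>T\<close> the number of earlier heads.\<close>

lemma mass_Cons_le_rate:
  assumes "good h" "length h \<le> T" "0 < r" "real n / r \<le> real n - 1 - m - T / K"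
  shows "mass (u # h) \<le> r / n * mass h"
proof (cases "u \<in> cand h")
  case True
  have n: "0 < real n" using s_less by simp
  have "length h / K \<le> T / K" using assms K_pos by (intro divide_right_mono) auto
  hence "real n / r \<le> real n - 1 - uses h (head h) - length h / K"
    using assms(4) good_uses[OF assms(1), of "head h"] by linarith
  hence "mass (u # h) * (real n / r) \<le> mass h"
    using mass_Cons_le[OF good_set[OF assms(1)] True] mult_left_mono[OF _ mass_nonneg[of "u # h"]]
    by (meson order_trans)
  thus ?thesis using assms(3) n by (simp add: field_simps)
next
  case False
  thus ?thesis using mass_not_cand[OF False] mass_nonneg[of h] assms(3) by simp
qed

text \<open>The value 4 is the one that a vertex takes when it joins the path: it has one used edge and is the head.\<close>

definition use_potential :: "nat \<Rightarrow> nat list \<Rightarrow> real" where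
  "use_potential v h = (if v \<in> set (path h) then 2 ^ uses h v else 4)"

lemma sum_moves_mass_le: "(\<Sum>u\<in>moves h. mass (u # h)) \<le> mass h"
proof -
  have "(\<Sum>u\<in>moves h. mass (u # h)) \<le> (\<Sum>u\<in>cand h. mass (u # h))"
    by (rule sum_mono2) (auto simp: moves_def finite_cand mass_nonneg)
  thus ?thesis using sum_mass_Cons_le[of h] by linarith
qed

text \<open>An extension makes a vertex off the old path the head, so only rotations can lead into
  \<open>W\<close>, and each vertex of \<open>W\<close> arises from at most one pick.\<close>

lemma sum_rotations_le:
  fixes q :: real
  assumes "good h" "finite W" "W \<subseteq> set (path h)" "\<And>u. mass (u # h) \<le> q" "0 \<le> q"
  shows "(\<Sum>u\<in>{u \<in> moves h. head (u # h) \<in> W}. mass (u # h)) \<le> card W * q"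
proof -
  let ?A = "{u \<in> moves h. head (u # h) \<in> W}"
  note h = good_set[OF assms(1)]
  have "?A \<subseteq> set (path h) - {head h}"
    using assms(3) head_extension by (force simp: moves_def cand_def)
  hence "inj_on (\<lambda>u. head (u # h)) ?A" using inj_on_head_rotation[OF h] inj_on_subset by blast
  hence "card ?A \<le> card W" using assms(2) by (intro card_inj_on_le) auto
  have "(\<Sum>u\<in>?A. mass (u # h)) \<le> card ?A * q"
    using assms(4) by (intro sum_bounded_above) auto
  also have "\<dots> \<le> card W * q" using \<open>card ?A \<le> card W\<close> assms(5) by (intro mult_right_mono) auto
  finally show ?thesis .
qed

text \<open>On the path, the potential doubles when \<open>v\<close> is picked or becomes the head
  by a rotation. Each event has share at most \<open>q\<close>, which gives the factor
  \<open>1 + 2 * q\<close>.\<close>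

lemma use_potential_step:
  assumes good: "good h" and q: "\<And>u. mass (u # h) \<le> q * mass h" "0 \<le> q"
  shows "(\<Sum>u\<in>moves h. mass (u # h) * use_potential v (u # h)) \<le> (1 + 2 * q) * (mass h * use_potential v h)"
proof (cases "v \<in> set (path h)")
  case False
  note h = good_set[OF good]
  have "use_potential v (u # h) = 4" if "u \<in> moves h" for u
  proof (cases "u = v")
    case True
    thus ?thesis using False head_extension[OF False] uses_off_path[OF h False] set_path_Cons[OF h, of u]
      by (simp add: use_potential_def del: path.simps)
  qed (use False set_path_Cons[OF h, of u] in \<open>simp add: use_potential_def del: path.simps\<close>)
  hence "(\<Sum>u\<in>moves h. mass (u # h) * use_potential v (u # h)) = (\<Sum>u\<in>moves h. mass (u # h)) * 4"
    by (simp add: sum_distrib_right)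
  also have "\<dots> \<le> mass h * 4" using sum_moves_mass_le[of h] by simp
  also have "\<dots> \<le> (1 + 2 * q) * (mass h * 4)" using q(2) mass_nonneg[of h] by (simp add: distrib_right)
  finally show ?thesis using False by (simp add: use_potential_def)
next
  case True
  note h = good_set[OF good]
  let ?P = "use_potential v h"
  have P: "0 \<le> ?P" by (simp add: use_potential_def)
  have "use_potential v (u # h) \<le> ?P * (1 + of_bool (u \<in> {v}) + of_bool (head (u # h) \<in> {v}))" if u: "u \<in> moves h" for u
  proof -
    \<comment> \<open>The two doublings exclude each other, so a sum of indicators can replace their
      product.\<close>
    have "\<not> (u = v \<and> head (u # h) = v)"
      using True head_rotation_neq[OF h, of v] u by (auto simp: moves_def cand_def)
    moreover have "use_potential v (u # h) = ?P * 2 ^ (of_bool (v = u) + of_bool (v = head (u # h)))"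
      using True set_path_Cons[OF h, of u] by (simp add: use_potential_def power_add del: path.simps)
    ultimately show ?thesis by auto
  qed
  hence "(\<Sum>u\<in>moves h. mass (u # h) * use_potential v (u # h)) \<le>
      (\<Sum>u\<in>moves h. mass (u # h) * (?P * (1 + of_bool (u \<in> {v}) + of_bool (head (u # h) \<in> {v}))))"
    by (intro sum_mono mult_left_mono mass_nonneg)
  also have "\<dots> = ?P * (\<Sum>u\<in>moves h. mass (u # h) + mass (u # h) * of_bool (u \<in> {v}) + mass (u # h) * of_bool (head (u # h) \<in> {v}))"
    by (simp only: sum_distrib_left ring_distribs mult_1_right mult_1_left mult_ac)
  also have "\<dots> = ?P * ((\<Sum>u\<in>moves h. mass (u # h)) + (\<Sum>u\<in>{u \<in> moves h. u \<in> {v}}. mass (u # h)) +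
     (\<Sum>u\<in>{u \<in> moves h. head (u # h) \<in> {v}}. mass (u # h)))"
    by (simp only: sum.distrib sum.inter_filter[OF finite_moves] of_bool_def if_distrib[of "(*) _"] mult_1_right mult_zero_right)
  also have "\<dots> \<le> ?P * (mass h + q * mass h + q * mass h)"
  proof (intro mult_left_mono add_mono P sum_moves_mass_le)
    have "(\<Sum>u\<in>{u \<in> moves h. u \<in> {v}}. mass (u # h)) \<le> (\<Sum>u\<in>{v}. mass (u # h))"
      by (rule sum_mono2) (auto simp: mass_nonneg)
    thus "(\<Sum>u\<in>{u \<in> moves h. u \<in> {v}}. mass (u # h)) \<le> q * mass h" using q(1)[of v] by simp
    show "(\<Sum>u\<in>{u \<in> moves h. head (u # h) \<in> {v}}. mass (u # h)) \<le> q * mass h"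
      using sum_rotations_le[OF good, of "{v}" "q * mass h"] True q mass_nonneg[of h] by simp
  qed
  also have "\<dots> = (1 + 2 * q) * (mass h * ?P)" by (simp add: algebra_simps)
  finally show ?thesis .
qed

text \<open>Markov's inequality with a union bound over the vertices: at an exit some vertex has
  potential at least \<open>2 powr m\<close>, while every initial potential is at most 4.\<close>

lemma sum_exits_le:
  assumes "0 < r" "real n / r \<le> real n - 1 - m - T / K"
  shows "(\<Sum>i=1..T. \<Sum>h\<in>exits i. mass h) \<le> 4 * real n * (1 + 2 * r / n) ^ T / 2 powr m"
proof -
  have one: "2 powr m \<le> (\<Sum>v<n. use_potential v h)" if exit: "h \<in> exits i" for h i
  proof -
    from exit obtain u h0 v where h0: "h = u # h0" "good h0" "u \<in> moves h0" and v: "m < real (uses h v)"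
      by (auto simp: exits_def not_le simp del: uses.simps)
    have h: "set h \<subseteq> {..<n}" using h0 good_set by (auto simp: moves_def cand_def)
    \<comment> \<open>This ensures that the potential of \<open>v\<close> is the power of 2 and not
      the value 4 reserved for vertices off the path.\<close>
    have "v \<in> set (path h)" using uses_off_path[OF h, of v] v m_ge_1 by force
    hence vn: "v < n" and P: "use_potential v h = 2 ^ uses h v" using set_path[OF h] by (auto simp: use_potential_def)
    have "2 powr m \<le> 2 powr (uses h v)" using v by simp
    also have "\<dots> = use_potential v h" by (simp add: P powr_realpow)
    also have "\<dots> \<le> (\<Sum>v<n. use_potential v h)"
      using vn by (intro member_le_sum) (auto simp: use_potential_def)
    finally show ?thesis .
  qed
  have "2 powr m * (\<Sum>i=1..T. \<Sum>h\<in>exits i. mass h) \<le> (\<Sum>i=1..T. \<Sum>h\<in>exits i. mass h * (\<Sum>v<n. use_potential v h))"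
  proof -
    have "2 powr m * mass h \<le> mass h * (\<Sum>v<n. use_potential v h)" if "h \<in> exits i" for h i
      using mult_left_mono[OF one[OF that] mass_nonneg[of h]] by (simp only: mult.commute)
    thus ?thesis unfolding sum_distrib_left[of "2 powr m"] by (intro sum_mono)
  qed
  also have "\<dots> = (\<Sum>i=1..T. \<Sum>h\<in>exits i. \<Sum>v<n. mass h * use_potential v h)"
    by (simp add: sum_distrib_left)
  also have "\<dots> = (\<Sum>i=1..T. \<Sum>v<n. \<Sum>h\<in>exits i. mass h * use_potential v h)"
    by (intro sum.cong refl sum.swap)
  also have "\<dots> = (\<Sum>v<n. \<Sum>i=1..T. \<Sum>h\<in>exits i. mass h * use_potential v h)"
    by (rule sum.swap)
  also have "\<dots> \<le> (\<Sum>v<n. (1 + 2 * r / n) ^ T * 4)"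
  proof (intro sum_mono)
    fix v
    have "(\<Sum>i=1..T. \<Sum>h\<in>exits i. mass h * use_potential v h) \<le>
      (\<Sum>h\<in>goods T. mass h * use_potential v h) + (\<Sum>i=1..T. \<Sum>h\<in>exits i. mass h * use_potential v h)"
      by (simp add: sum_nonneg mass_nonneg use_potential_def)
    also have "\<dots> \<le> (1 + 2 * (r / n)) ^ T * use_potential v []"
    proof (rule potential_exits_bound[where T = T])
      fix h assume h: "good h" "length h < T"
      show "(\<Sum>u\<in>moves h. mass (u # h) * use_potential v (u # h)) \<le> (1 + 2 * (r / n)) * (mass h * use_potential v h)"
        using assms(1) h by (intro use_potential_step mass_Cons_le_rate[OF _ _ assms]) auto
    qed (use assms(1) in \<open>auto simp: use_potential_def\<close>)
    also have "\<dots> \<le> (1 + 2 * (r / n)) ^ T * 4"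
      using assms by (intro mult_left_mono) (auto simp: use_potential_def)
    finally show "(\<Sum>i=1..T. \<Sum>h\<in>exits i. mass h * use_potential v h) \<le> (1 + 2 * r / n) ^ T * 4" by simp
  qed
  also have "\<dots> = 4 * real n * (1 + 2 * r / n) ^ T" by simp
  finally show ?thesis by (simp add: pos_le_divide_eq mult.commute)
qed

section \<open>Progress towards a closed cycle\<close>

lemma good_length_path:
  assumes "good h" "h \<noteq> []"
  shows "2 \<le> length (path h)"
  using assms
proof (induction h)
  case (Cons u h)
  hence u: "u \<in> cand h" "good h" by (auto simp: moves_def)
  hence un: "u < n" by (simp add: cand_def)
  show ?case
  proof (cases "h = []")
    case True
    thus ?thesis using u by (simp add: cand_def head_def)
  next
    case False
    thus ?thesis using Cons.IH u length_path_Cons[OF good_set[OF u(2)] un] by linarith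
  qed
qed simp

text \<open>From the first pick on the path has at least two vertices and still begins with
  \<open>s\<close>, so its end is another vertex.\<close>

lemma heads_start_le_1:
  assumes "good h"
  shows "heads h s \<le> 1"
  using assms
proof (induction h)
  case (Cons u h)
  show ?case
  proof (cases "h = []")
    case False
    hence "head h \<noteq> s" using Cons.prems good_length_path head_neq_start good_set by auto
    thus ?thesis using Cons by auto
  qed auto
qed simp

text \<open>
  Every vertex off the path is hit at rate at least \<open>1 / n\<close>, and so is \<open>s\<close> once the path is
  complete, up to the factor \<open>1 + 1 / K\<close>, unless the edge from the head to \<open>s\<close> has been used. The
  summand \<open>2 / n\<close> pays for the latter, rare case.
\<close>

definition progress_potential :: "nat list \<Rightarrow> real" where
  "progress_potential h =
     (if length (path h) < n then 3 * (real n - real (length (path h))) + 1 + 2 / n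
      else if {head h, s} \<in> used h then 1 + 2 / n else 1)"

lemma progress_potential_ge_1: "1 \<le> progress_potential h"
proof (cases "length (path h) < n")
  case True
  define b where "b = 2 / real n"
  have "real (length (path h)) < real n" "0 \<le> b" using True by (simp_all add: b_def)
  thus ?thesis using True unfolding progress_potential_def b_def[symmetric] by simp
qed (simp add: progress_potential_def)

text \<open>The exchange inequality with \<open>u\<close> as the fixed comparison vertex; this is
  the lower bound on the rate at which \<open>u\<close> is picked.\<close>

lemma sum_cand_mass_le:
  assumes "good h" "u \<in> cand h"
  shows "(\<Sum>u'\<in>cand h. mass (u' # h)) \<le> real n * ((1 + 1 / K) ^ heads h u * mass (u # h))"
proof -
  note h = good_set[OF assms(1)]
  let ?q = "(1 + 1 / K) ^ heads h u * mass (u # h)"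
  have "0 \<le> ?q" using K_pos mass_nonneg by simp
  have "(\<Sum>u'\<in>cand h. mass (u' # h)) \<le> card (cand h) * ?q"
    by (intro sum_bounded_above mass_Cons_le_mass_Cons h assms(2))
  also have "\<dots> \<le> real n * ?q"
    using card_cand_le[OF h] \<open>0 \<le> ?q\<close> by (intro mult_right_mono) auto
  finally show ?thesis .
qed

text \<open>Each of the \<open>N\<close> vertices off the path receives at least the share
  \<open>1 / n\<close>, and reaching one lowers the potential by at least 3; the expected drop
  \<open>3 * N / n\<close> is large enough in proportion to the potential.\<close>

lemma progress_potential_step_incomplete:
  assumes good: "good h" and n: "4 \<le> n" and len: "length (path h) < n"
  shows "(\<Sum>u\<in>moves h. mass (u # h) * progress_potential (u # h)) \<le> (1 - 2 / (3 * n)) * (mass h * progress_potential h)"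
proof -
  note h = good_set[OF good]
  define N where "N = real n - real (length (path h))"
  define M where "M = (\<Sum>u\<in>cand h. mass (u # h))"
  define B where "B = {..<n} - set (path h)"
  define b where "b = 2 / real n"
  have b: "0 \<le> b" "b \<le> 1 / 2" using n by (auto simp: b_def field_simps)
  have moves: "moves h = cand h" using len by (auto simp: moves_def)
  have N: "1 \<le> N" using len by (simp add: N_def)
  have "card B = n - card (set (path h))" unfolding B_def using set_path[OF h] by (subst card_Diff_subset) auto
  hence cB: "real (card B) = N" using length_path[OF h] len by (simp add: N_def of_nat_diff)
  have Bc: "B \<subseteq> cand h" unfolding B_def using off_path_in_cand[OF h] by auto
  have M: "0 \<le> M" "M \<le> mass h" unfolding M_def by (simp_all add: sum_nonneg mass_nonneg sum_mass_Cons_le)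
  have pot: "progress_potential (u # h) \<le> 3 * N + 1 + b - 3 * of_bool (u \<in> B)" if "u \<in> cand h" for u
  proof -
    have "u < n" using that by (simp add: cand_def)
    hence "real (length (path (u # h))) = real (length (path h)) + of_bool (u \<in> B)"
      using length_path_Cons[OF h, of u] unfolding B_def by simp
    \<comment> \<open>On a complete path both possible values are at most \<open>1 + b\<close>, so
      the formula with no vertex left covers them.\<close>
    moreover have "progress_potential (u # h) \<le> 3 * (real n - real (length (path (u # h)))) + 1 + b"
      using b length_path[of "u # h"] h \<open>u < n\<close> card_mono[OF _ set_path[of "u # h"]]
      unfolding progress_potential_def b_def[symmetric] by (auto simp del: path.simps)
    ultimately show ?thesis by (simp add: N_def)
  qed
  have "(\<Sum>u\<in>moves h. mass (u # h) * progress_potential (u # h)) \<le>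
     (\<Sum>u\<in>cand h. mass (u # h) * (3 * N + 1 + b - 3 * of_bool (u \<in> B)))"
    unfolding moves by (intro sum_mono mult_left_mono pot mass_nonneg)
  also have "\<dots> = (3 * N + 1 + b) * M - 3 * (\<Sum>u\<in>cand h. mass (u # h) * of_bool (u \<in> B))"
    unfolding M_def by (simp add: right_diff_distrib sum_subtractf sum_distrib_left mult_ac)
  also have "(\<Sum>u\<in>cand h. mass (u # h) * of_bool (u \<in> B)) = (\<Sum>u\<in>B. mass (u # h))"
    using Bc finite_cand by (intro sum.mono_neutral_cong_right) auto
  also have "(3 * N + 1 + b) * M - 3 * (\<Sum>u\<in>B. mass (u # h)) \<le> (3 * N + 1 + b) * M - 3 * (N * (M / n))"
  proof -
    have "M / n \<le> mass (u # h)" if "u \<in> B" for u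
    proof -
      have "heads h u = 0" using heads_off_path[OF h] that by (simp add: B_def)
      hence "M \<le> real n * mass (u # h)" using sum_cand_mass_le[OF good, of u] Bc that by (auto simp: M_def)
      thus ?thesis using n by (simp add: field_simps)
    qed
    from sum_bounded_below[of B "M / n" "\<lambda>u. mass (u # h)", OF this] show ?thesis unfolding cB by simp
  qed
  also have "\<dots> = M * (3 * N + 1 + b) - M * (3 * N / n)" by (simp add: algebra_simps)
  also have "\<dots> \<le> M * (3 * N + 1 + b) - M * (2 * (3 * N + 1 + b) / (3 * n))"
  proof (intro diff_left_mono mult_left_mono M)
    \<comment> \<open>For \<open>N \<ge> 1\<close> and \<open>b \<le> 1 / 2\<close> the potential
      \<open>3 * N + 1 + b\<close> is at most \<open>9 * N / 2\<close>; this yields the rate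
      \<open>2 / (3 * n)\<close>.\<close>
    have "2 * (3 * N + 1 + b) / 3 / n \<le> 3 * N / n" using N b by (intro divide_right_mono) auto
    thus "2 * (3 * N + 1 + b) / (3 * n) \<le> 3 * N / n" by (simp only: divide_divide_eq_left)
  qed
  also have "\<dots> = (1 - 2 / (3 * n)) * (M * (3 * N + 1 + b))" using n by (simp add: field_simps)
  also have "\<dots> \<le> (1 - 2 / (3 * n)) * (mass h * (3 * N + 1 + b))"
    using M N b n by (intro mult_left_mono mult_right_mono) auto
  also have "3 * N + 1 + b = progress_potential h" using len by (simp add: progress_potential_def N_def b_def)
  finally show ?thesis .
qed

text \<open>At most \<open>m\<close> vertices have used their edge to \<open>s\<close>. The new head
  is one of them with share at most \<open>m * r / n \<le> 1 / 12\<close>, which costs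
  \<open>1 / (6 * n)\<close>. If the present head can still pick \<open>s\<close>, it does so with
  share at least \<open>5 / (6 * n)\<close>, and \<open>5 / 6 - 1 / 6 = 2 / 3\<close>. Otherwise the
  surplus \<open>2 / n\<close> in the present potential pays.\<close>

lemma progress_potential_step_complete:
  assumes good: "good h" and n: "4 \<le> n" and len: "length (path h) = n"
    and q: "\<And>u. mass (u # h) \<le> r / n * mass h" "0 \<le> r" and mr: "12 * (m * r) \<le> n" and K: "5 \<le> K"
  shows "(\<Sum>u\<in>moves h. mass (u # h) * progress_potential (u # h)) \<le> (1 - 2 / (3 * n)) * (mass h * progress_potential h)"
proof -
  note h = good_set[OF good]
  define W where "W = {w. {s, w} \<in> used h}"
  define b where "b = 2 / real n"
  have b: "0 \<le> b" "b \<le> 1 / 2" using n by (auto simp: b_def field_simps)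
  have hs: "head h \<noteq> s" using head_neq_start[OF h] len n by simp
  have full: "set (path h) = {..<n}" using path_full_iff[OF h] len by simp
  have W: "finite W" "W \<subseteq> set (path h)" "real (card W) \<le> m"
  proof -
    show "finite W" unfolding W_def by (rule finite_neighbours[OF finite_used])
    show "W \<subseteq> set (path h)" unfolding W_def using used_subset_path[OF h] by auto
    show "real (card W) \<le> m"
      using card_used_neighbours_le[of s h] good_uses[OF good, of s] unfolding W_def by linarith
  qed
  have pot: "progress_potential (u # h) = 1 + b * of_bool (head (u # h) \<in> W)" if u: "u \<in> moves h" for u
  proof -
    have "u < n" "u \<noteq> s" using u len by (auto simp: moves_def cand_def)
    hence "length (path (u # h)) = n" using length_path_Cons[OF h, of u] full len by simp
    \<comment> \<open>The newly used edge does not contain \<open>s\<close>, so \<open>W\<close>,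
      taken from the old history, still describes the used edges at \<open>s\<close>.\<close>
    moreover have "{head (u # h), s} \<in> used (u # h) \<longleftrightarrow> head (u # h) \<in> W"
      using \<open>u \<noteq> s\<close> hs by (auto simp: W_def doubleton_eq_iff insert_commute)
    ultimately show ?thesis by (simp add: progress_potential_def b_def del: used.simps path.simps)
  qed
  have "(\<Sum>u\<in>moves h. mass (u # h) * progress_potential (u # h)) =
    (\<Sum>u\<in>moves h. mass (u # h)) + b * (\<Sum>u\<in>moves h. mass (u # h) * of_bool (head (u # h) \<in> W))"
    using pot by (simp add: sum.distrib sum_distrib_left distrib_left mult_ac)
  also have "(\<Sum>u\<in>moves h. mass (u # h) * of_bool (head (u # h) \<in> W)) = (\<Sum>u\<in>{u \<in> moves h. head (u # h) \<in> W}. mass (u # h))"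
    using finite_moves by (intro sum.mono_neutral_cong_right) auto
  also have "b * \<dots> \<le> b * (m * (r / n * mass h))"
  proof (intro mult_left_mono b)
    have "(\<Sum>u\<in>{u \<in> moves h. head (u # h) \<in> W}. mass (u # h)) \<le> card W * (r / n * mass h)"
      using q mass_nonneg[of h] by (intro sum_rotations_le[OF good W(1,2)]) auto
    also have "\<dots> \<le> m * (r / n * mass h)" using W(3) q mass_nonneg[of h] by (intro mult_right_mono) auto
    finally show "(\<Sum>u\<in>{u \<in> moves h. head (u # h) \<in> W}. mass (u # h)) \<le> m * (r / n * mass h)" .
  qed
  also have "b * (m * (r / n * mass h)) = (b * (m * r) / n) * mass h" by (simp add: mult_ac)
  also have "\<dots> \<le> (1 / (6 * n)) * mass h"
    using mr n mass_nonneg[of h] by (intro mult_right_mono) (auto simp: b_def field_simps)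
  finally have *: "(\<Sum>u\<in>moves h. mass (u # h) * progress_potential (u # h)) \<le>
    (\<Sum>u\<in>moves h. mass (u # h)) + (1 / (6 * n)) * mass h" by simp
  show ?thesis
  proof (cases "{head h, s} \<in> used h")
    case True
    have "(\<Sum>u\<in>moves h. mass (u # h) * progress_potential (u # h)) \<le> (1 + 1 / (6 * n)) * mass h"
      using * sum_moves_mass_le[of h] by (simp add: distrib_right)
    also have "\<dots> \<le> ((1 - 2 / (3 * n)) * (1 + b)) * mass h"
      using n mass_nonneg[of h] by (intro mult_right_mono) (auto simp: b_def field_simps)
    finally show ?thesis using True len by (simp add: progress_potential_def b_def mult_ac)
  next
    case False
    define M where "M = (\<Sum>u\<in>cand h. mass (u # h))"
    have M: "0 \<le> M" "M \<le> mass h" unfolding M_def by (simp_all add: sum_nonneg mass_nonneg sum_mass_Cons_le)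
    have sc: "s \<in> cand h" using False hs s_less by (auto simp: cand_def)
    have "moves h = cand h - {s}" using len by (auto simp: moves_def)
    hence moves: "(\<Sum>u\<in>moves h. mass (u # h)) = M - mass (s # h)"
      using sum.remove[OF finite_cand sc, of "\<lambda>u. mass (u # h)"] by (simp add: M_def)
    have "M \<le> real n * ((1 + 1 / K) ^ heads h s * mass (s # h))"
      using sum_cand_mass_le[OF good sc] by (simp add: M_def)
    also have "\<dots> \<le> real n * ((6 / 5) * mass (s # h))"
    proof (intro mult_left_mono mult_right_mono mass_nonneg)
      have "(1 + 1 / K) ^ heads h s \<le> (1 + 1 / K) ^ 1"
        using heads_start_le_1[OF good] K by (intro power_increasing) auto
      also have "\<dots> \<le> 6 / 5" using K by (simp add: field_simps)
      finally show "(1 + 1 / K) ^ heads h s \<le> 6 / 5" .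
    qed auto
    finally have "5 / (6 * n) * M \<le> mass (s # h)" using n by (simp add: field_simps)
    hence "(\<Sum>u\<in>moves h. mass (u # h)) \<le> (1 - 5 / (6 * n)) * M" unfolding moves by (simp add: left_diff_distrib)
    also have "\<dots> \<le> (1 - 5 / (6 * n)) * mass h" using M n by (intro mult_left_mono) (auto simp: field_simps)
    finally have "(\<Sum>u\<in>moves h. mass (u # h) * progress_potential (u # h)) \<le> (1 - 5 / (6 * n) + 1 / (6 * n)) * mass h"
      unfolding distrib_right[of _ _ "mass h"] using * by linarith
    also have "1 - 5 / (6 * n) + 1 / (6 * n) = 1 - 2 / (3 * real n)" using n by (simp add: field_simps)
    finally show ?thesis using False len by (simp add: progress_potential_def)
  qed
qed

lemma sum_goods_le:
  assumes "4 \<le> n" "5 \<le> K" "0 < r" "real n / r \<le> real n - 1 - m - T / K" "12 * (m * r) \<le> n"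
  shows "(\<Sum>h\<in>goods T. mass h) \<le> 5 * real n * (1 - 2 / (3 * n)) ^ T"
proof -
  have "(\<Sum>h\<in>goods T. mass h) \<le> (\<Sum>h\<in>goods T. mass h * progress_potential h)"
    using mult_left_mono[OF progress_potential_ge_1 mass_nonneg] by (intro sum_mono) fastforce
  also have "\<dots> \<le> (1 - 2 / (3 * n)) ^ T * progress_potential []"
  proof (rule potential_bound[where T = T])
    fix h assume h: "good h" "length h < T"
    show "(\<Sum>u\<in>moves h. mass (u # h) * progress_potential (u # h)) \<le> (1 - 2 / (3 * n)) * (mass h * progress_potential h)"
    proof (cases "length (path h) < n")
      case True
      show ?thesis by (rule progress_potential_step_incomplete[OF h(1) assms(1) True])
    next
      case False
      have "length (path h) \<le> n"
        using length_path[OF good_set[OF h(1)]] card_mono[OF _ set_path[OF good_set[OF h(1)]]] by simp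
      hence "length (path h) = n" using False by simp
      thus ?thesis using assms h
        by (intro progress_potential_step_complete[where r = r] mass_Cons_le_rate[OF _ _ assms(3,4)]) auto
    qed
  qed (use progress_potential_ge_1 assms(1) in \<open>auto intro: order_trans[of 0 1] simp: field_simps\<close>)
  also have "\<dots> \<le> (1 - 2 / (3 * n)) ^ T * (5 * real n)"
  proof (intro mult_left_mono zero_le_power)
    define b where "b = 2 / real n"
    have "b \<le> 1" using assms(1) by (simp add: b_def)
    thus "progress_potential [] \<le> 5 * real n"
      using assms(1) unfolding progress_potential_def b_def[symmetric] by simp
  qed (use assms(1) in \<open>simp add: field_simps\<close>)
  finally show ?thesis by (simp add: mult.commute)
qed

section \<open>Success probability\<close>

lemma card_unused_ge:
  assumes "E \<subseteq> all_edges n" "good h" "K + m \<le> real (card {u. u \<noteq> v \<and> {v, u} \<in> E})"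
  shows "K \<le> real (card (unused E h v))"
proof -
  have "card {u. u \<noteq> v \<and> {v, u} \<in> E} \<le> card (unused E h v \<union> {u. {v, u} \<in> used h})"
    by (rule card_mono) (use finite_unused[OF assms(1)] finite_neighbours[OF finite_used] in \<open>auto simp: unused_def\<close>)
  also have "\<dots> \<le> card (unused E h v) + card {u. {v, u} \<in> used h}" by (rule card_Un_le)
  also have "\<dots> \<le> card (unused E h v) + uses h v" using card_used_neighbours_le by simp
  finally show ?thesis using assms(3) good_uses[OF assms(2), of v] by linarith
qed

text \<open>\<open>f\<close> plays the role of a failure indicator. The induction peels off the last
  step and replaces \<open>f\<close> by its expectation after one step, so \<open>f\<close> has to
  be general. The degree bound keeps good histories away from \<open>Stuck\<close>; an exit is
  charged its full weight, whatever happens afterwards.\<close>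

lemma expectation_dra_run_le:
  assumes E: "E \<subseteq> all_edges n" and n: "3 \<le> n"
    and deg: "\<And>v. v < n \<Longrightarrow> K + m \<le> real (card {u. u \<noteq> v \<and> {v, u} \<in> E})"
    and "\<And>st. 0 \<le> f st" "\<And>st. f st \<le> 1" "\<And>vs. ham_cycle n E vs \<Longrightarrow> f (Success vs) = 0"
  shows "measure_pmf.expectation (dra_run n E s k) f \<le>
    (\<Sum>h\<in>goods k. weight E h * f (Running (unused E h) (path h))) + (\<Sum>i=1..k. \<Sum>h\<in>exits i. weight E h)"
  using assms(4-6)
proof (induction k arbitrary: f)
  case 0
  have "dra_init E s = Running (unused E []) (path [])" by (simp add: dra_init_def unused_def fun_eq_iff)
  thus ?case by (simp add: goods_0)
next
  case (Suc k)
  define g where "g st = measure_pmf.expectation (dra_step n st) f" for st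
  have g: "0 \<le> g st" "g st \<le> 1" for st unfolding g_def by (intro expectation_unit Suc.prems)+
  have gS: "g (Success vs) = 0" if "ham_cycle n E vs" for vs using Suc.prems(3)[OF that] by (simp add: g_def)
  have step: "weight E h * g (Running (unused E h) (path h)) \<le>
      (\<Sum>u\<in>moves h. weight E (u # h) * f (Running (unused E (u # h)) (path (u # h))))" if good: "good h" for h
  proof (cases "weight E h = 0")
    case False
    note h = good_set[OF good]
    let ?U = "unused E h (head h)"
    have K: "K \<le> real (card ?U)" by (rule card_unused_ge[OF E good deg]) (rule head_less[OF h])
    hence U: "finite ?U" "?U \<noteq> {}" using K_pos finite_unused[OF E] by auto
    have wt: "weight E (u # h) = weight E h * (1 / card ?U)" if "u \<in> ?U" for u using that K by (simp add: max_def)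
    have sub: "?U \<subseteq> cand h" by (rule unused_head_subset_cand[OF E])
    have "g (Running (unused E h) (path h)) = (\<Sum>u\<in>?U. f (dra_move n (unused E h) (path h) u)) / card ?U"
      using U by (simp add: g_def head_def[symmetric] integral_pmf_of_set)
    hence "weight E h * g (Running (unused E h) (path h)) =
        (\<Sum>u\<in>?U. weight E (u # h) * f (dra_move n (unused E h) (path h) u))"
      using wt by (simp add: sum_distrib_left sum_divide_distrib del: weight.simps)
    also have "\<dots> \<le> (\<Sum>u\<in>?U \<inter> moves h. weight E (u # h) * f (Running (unused E (u # h)) (path (u # h))))"
    proof -
      have "weight E (u # h) * f (dra_move n (unused E h) (path h) u) =
          (if u \<in> moves h then weight E (u # h) * f (Running (unused E (u # h)) (path (u # h))) else 0)" if u: "u \<in> ?U" for u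
      proof (cases "length (path h) = n \<and> u = s")
        case True
        \<comment> \<open>The closing pick contributes nothing because \<open>f\<close> vanishes at
          a Hamiltonian cycle.\<close>
        hence "ham_cycle n E (path h)" using ham_cycle_path[OF h False _ n] u by blast
        thus ?thesis using True Suc.prems(3) sub u dra_move_eq[OF h, of u E]
          by (auto simp: moves_def simp del: weight.simps path.simps)
      next
        case False
        thus ?thesis using sub u dra_move_eq[OF h, of u E]
          by (auto simp: moves_def simp del: weight.simps path.simps)
      qed
      thus ?thesis using U by (simp add: sum.inter_restrict del: weight.simps path.simps)
    qed
    also have "\<dots> \<le> (\<Sum>u\<in>moves h. weight E (u # h) * f (Running (unused E (u # h)) (path (u # h))))"
      by (rule sum_mono2) (use finite_moves weight_nonneg Suc.prems in \<open>auto simp del: weight.simps\<close>)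
    finally show ?thesis .
  qed (auto intro!: sum_nonneg mult_nonneg_nonneg weight_nonneg Suc.prems simp del: weight.simps)
  have "measure_pmf.expectation (dra_run n E s (Suc k)) f = measure_pmf.expectation (dra_run n E s k) g"
    unfolding g_def by (simp add: expectation_bind_pmf_unit Suc.prems)
  also have "\<dots> \<le> (\<Sum>h\<in>goods k. weight E h * g (Running (unused E h) (path h))) + (\<Sum>i=1..k. \<Sum>h\<in>exits i. weight E h)"
    by (rule Suc.IH) (use g gS in auto)
  also have "(\<Sum>h\<in>goods k. weight E h * g (Running (unused E h) (path h))) \<le>
      (\<Sum>h\<in>goods k. \<Sum>u\<in>moves h. weight E (u # h) * f (Running (unused E (u # h)) (path (u # h))))"
    by (intro sum_mono step) (simp add: goods_def)
  also have "\<dots> = (\<Sum>h\<in>goods (Suc k). weight E h * f (Running (unused E h) (path h))) +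
      (\<Sum>h\<in>exits (Suc k). weight E h * f (Running (unused E h) (path h)))"
    by (rule sum_goods_exits_Suc[symmetric])
  also have "(\<Sum>h\<in>exits (Suc k). weight E h * f (Running (unused E h) (path h))) \<le> (\<Sum>h\<in>exits (Suc k). weight E h)"
    by (intro sum_mono mult_left_le weight_nonneg Suc.prems)
  finally show ?case by simp
qed

text \<open>The three terms account for a vertex of low degree, a walk still running after
  \<open>T\<close> steps, and a vertex with too many used edges.\<close>

lemma prob_failure_le:
  assumes n: "4 \<le> n" and "5 \<le> K" "0 < r" "real n / r \<le> real n - 1 - m - T / K" "12 * (m * r) \<le> n"
  shows "1 - measure_pmf.prob (dra_on_gnp n p s T) (constructs_ham_cycle n) \<le>
    n * exp ((K + m) / 3 - 5 / 18 * p * (real n - 1)) + 5 * real n * (1 - 2 / (3 * n)) ^ T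
      + 4 * real n * (1 + 2 * r / n) ^ T / 2 powr m"
proof -
  define f :: "nat set set \<times> dra_state \<Rightarrow> real" where "f = indicator (- constructs_ham_cycle n)"
  have f: "0 \<le> f x" "f x \<le> 1" for x by (auto simp: f_def indicator_def)
  define low where "low = {E. \<exists>v<n. real (card {u. u \<noteq> v \<and> {v, u} \<in> E}) < K + m}"
  define err where "err E = measure_pmf.expectation (dra_run n E s T) (\<lambda>st. f (E, st))" for E
  define w where "w E = (\<Sum>h\<in>goods T. weight E h) + (\<Sum>i=1..T. \<Sum>h\<in>exits i. weight E h)" for E
  have w0: "0 \<le> w E" for E unfolding w_def by (intro add_nonneg_nonneg sum_nonneg weight_nonneg)
  have err: "err E \<le> indicator low E + w E" if E: "E \<subseteq> all_edges n" for E
  proof (cases "E \<in> low")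
    case True
    have "err E \<le> 1" unfolding err_def by (intro expectation_unit f)
    thus ?thesis using True w0[of E] by simp
  next
    case False
    hence deg: "K + m \<le> real (card {u. u \<noteq> v \<and> {v, u} \<in> E})" if "v < n" for v
      using that unfolding low_def mem_Collect_eq by (meson not_less)
    have "err E \<le> (\<Sum>h\<in>goods T. weight E h * f (E, Running (unused E h) (path h))) + (\<Sum>i=1..T. \<Sum>h\<in>exits i. weight E h)"
      unfolding err_def
      by (rule expectation_dra_run_le[OF E _ deg])
        (use n f in \<open>auto simp: f_def constructs_ham_cycle_def\<close>)
    also have "(\<Sum>h\<in>goods T. weight E h * f (E, Running (unused E h) (path h))) \<le> (\<Sum>h\<in>goods T. weight E h)"
      by (intro sum_mono mult_left_le weight_nonneg f)
    finally show ?thesis using False by (simp add: w_def)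
  qed
  have "1 - measure_pmf.prob (dra_on_gnp n p s T) (constructs_ham_cycle n) =
      measure_pmf.prob (dra_on_gnp n p s T) (- constructs_ham_cycle n)"
    using measure_pmf.prob_compl[of "constructs_ham_cycle n" "dra_on_gnp n p s T"] by (simp add: Compl_eq_Diff_UNIV)
  also have "\<dots> = measure_pmf.expectation (dra_on_gnp n p s T) f" by (simp add: f_def)
  also have "\<dots> = measure_pmf.expectation (gnp n p) err"
    unfolding dra_on_gnp_def err_def by (simp add: expectation_bind_pmf_unit f)
  also have "\<dots> = (\<Sum>E\<in>Pow (all_edges n). pmf (gnp n p) E * err E)"
    using set_pmf_gnp[of n p] by (subst integral_measure_pmf[of "Pow (all_edges n)"]) (auto simp: finite_all_edges)
  also have "\<dots> \<le> (\<Sum>E\<in>Pow (all_edges n). pmf (gnp n p) E * (indicator low E + w E))"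
    by (intro sum_mono mult_left_mono err) auto
  also have "\<dots> = (\<Sum>E\<in>Pow (all_edges n). pmf (gnp n p) E * indicator low E) + (\<Sum>E\<in>Pow (all_edges n). pmf (gnp n p) E * w E)"
    by (simp add: distrib_left sum.distrib)
  also have "(\<Sum>E\<in>Pow (all_edges n). pmf (gnp n p) E * indicator low E) = measure_pmf.expectation (gnp n p) (indicator low)"
    using set_pmf_gnp[of n p] by (subst integral_measure_pmf[of "Pow (all_edges n)"]) (auto simp: finite_all_edges)
  also have "\<dots> = measure_pmf.prob (gnp n p) low" by simp
  also have "(\<Sum>E\<in>Pow (all_edges n). pmf (gnp n p) E * w E) = (\<Sum>h\<in>goods T. mass h) + (\<Sum>i=1..T. \<Sum>h\<in>exits i. mass h)"
  proof -
    have "(\<Sum>E\<in>Pow (all_edges n). pmf (gnp n p) E * (\<Sum>h\<in>H. weight E h)) = (\<Sum>h\<in>H. mass h)" for H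
      unfolding mass_def sum_distrib_left by (rule sum.swap)
    moreover have "(\<Sum>E\<in>Pow (all_edges n). pmf (gnp n p) E * (\<Sum>i=1..T. \<Sum>h\<in>exits i. weight E h)) =
      (\<Sum>i=1..T. \<Sum>E\<in>Pow (all_edges n). pmf (gnp n p) E * (\<Sum>h\<in>exits i. weight E h))"
      by (subst sum_distrib_left) (rule sum.swap)
    ultimately show ?thesis unfolding w_def by (simp add: distrib_left sum.distrib)
  qed
  also have "measure_pmf.prob (gnp n p) low \<le> n * exp ((K + m) / 3 - 5 / 18 * p * (real n - 1))"
  proof -
    let ?L = "\<lambda>v. {E. real (card {u. u \<noteq> v \<and> {v, u} \<in> E}) < K + m}"
    have "low = (\<Union>v<n. ?L v)" by (auto simp: low_def)
    hence "measure_pmf.prob (gnp n p) low \<le> (\<Sum>v<n. measure_pmf.prob (gnp n p) (?L v))"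
      by (simp add: measure_pmf.finite_measure_subadditive_finite)
    also have "\<dots> \<le> (\<Sum>v<n. exp ((K + m) / 3 - 5 / 18 * p * (real n - 1)))"
      by (intro sum_mono degree_gnp_lower_tail p_nonneg p_le_1) auto
    finally show ?thesis by simp
  qed
  also note sum_goods_le[OF assms]
  also note sum_exits_le[OF assms(3,4)]
  finally show ?thesis by simp
qed

end

text \<open>With \<open>L = ln n\<close> the choices are \<open>K = 22 * L\<close>,
  \<open>m = 36 * L\<close> and \<open>r = 1.49\<close>; then \<open>T / K\<close> is at most
  \<open>7 * n / 22\<close>, and \<open>1 - 7 / 22\<close> exceeds \<open>1 / 1.49\<close> with room
  for the lower-order terms. The three terms of the failure bound are at most 1, 15 and 4 times
  \<open>n * exp (- 4 * L)\<close>, that is, \<open>1 / n ^ 3\<close>.\<close>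

lemma success_probability_large:
  assumes s: "s < n" and p: "86 * ln (real n) / real n \<le> p" "p \<le> 1"
    and n: "1000 \<le> n" and ln: "10000 * ln (real n) \<le> real n"
  shows "1 - 20 / real n ^ 3 \<le>
    measure_pmf.prob (dra_on_gnp n p s (nat \<lfloor>7 * real n * ln (real n)\<rfloor>)) (constructs_ham_cycle n)"
proof -
  define L where "L = ln (real n)"
  define T where "T = nat \<lfloor>7 * real n * L\<rfloor>"
  define x where "x = exp (- 4 * L)"
  have L1: "1 \<le> L"
  proof -
    have "exp 1 \<le> real n" by (rule order_trans[OF exp_le]) (use n in simp)
    thus ?thesis unfolding L_def using n by (subst ln_ge_iff) auto
  qed
  have expL: "exp L = real n" using n by (simp add: L_def)
  have T: "7 * real n * L - 1 \<le> T" "T \<le> 7 * real n * L"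
    using L1 n unfolding T_def by (auto intro!: order.strict_implies_order simp: of_nat_nat le_floor_iff)
  have p': "86 * L / n \<le> p" using p by (simp add: L_def)
  interpret capped_walk n s p "22 * L" "36 * L"
  proof
    show "0 \<le> p" by (rule order_trans[OF _ p']) (use L1 in auto)
  qed (use s p L1 in auto)
  have "n * x = 1 / real n ^ 3"
  proof -
    have "x = inverse (exp L ^ 4)" unfolding x_def exp_of_nat_mult[symmetric] by (simp add: exp_minus)
    thus ?thesis using n by (simp add: expL power_numeral_reduce field_simps)
  qed
  have "T / (22 * L) \<le> (7 * real n * L) / (22 * L)" using T L1 by (intro divide_right_mono) auto
  also have "\<dots> = 7 * n / 22" using L1 by simp
  finally have TK: "T / (22 * L) \<le> 7 * n / 22" .
  have "1 - measure_pmf.prob (dra_on_gnp n p s T) (constructs_ham_cycle n) \<le>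
    n * exp ((22 * L + 36 * L) / 3 - 5 / 18 * p * (real n - 1)) + 5 * real n * (1 - 2 / (3 * n)) ^ T
      + 4 * real n * (1 + 2 * (149 / 100) / n) ^ T / 2 powr (36 * L)"
    by (rule prob_failure_le) (use n L1 ln TK in \<open>auto simp: L_def[symmetric]\<close>)
  also have "\<dots> \<le> n * x + 5 * real n * (3 * x) + 4 * real n * x"
  proof (intro add_mono)
    have "86 * L / n * (real n - 1) \<le> p * (real n - 1)" using p' n by (intro mult_right_mono) auto
    moreover have "86 * L / n * (real n - 1) = 86 * L - 86 * (L / n)" using n by (simp add: field_simps)
    moreover have "L / n \<le> 1 / 100" using ln n by (simp add: L_def field_simps)
    ultimately have "86 * L - 1 \<le> p * (real n - 1)" by linarith
    thus "n * exp ((22 * L + 36 * L) / 3 - 5 / 18 * p * (real n - 1)) \<le> n * x"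
      unfolding x_def using L1 by (intro mult_left_mono) auto
  next
    have "(1 - 2 / (3 * n)) ^ T \<le> exp (- (2 / (3 * n))) ^ T"
      using n exp_ge_add_one_self[of "- (2 / (3 * real n))"] by (intro power_mono) auto
    also have "\<dots> = exp (- (2 / (3 * n) * T))" by (simp add: exp_of_nat_mult[symmetric] mult.commute)
    \<comment> \<open>Rounding \<open>T\<close> down costs at most a factor
      \<open>exp 1 \<le> 3\<close>; the exponent \<open>14 / 3 * L\<close> is weakened to
      \<open>4 * L\<close>.\<close>
    also have "\<dots> \<le> exp (1 + - 4 * L)"
    proof -
      have "2 / (3 * n) * (7 * real n * L - 1) \<le> 2 / (3 * n) * T" using T by (intro mult_left_mono) auto
      moreover have "2 / (3 * n) * (7 * real n * L - 1) = 14 / 3 * L - 2 / (3 * n)" using n by (simp add: field_simps)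
      moreover have "2 / (3 * real n) \<le> 1" using n by simp
      ultimately have "14 / 3 * L - 1 \<le> 2 / (3 * n) * T" by linarith
      thus ?thesis using L1 by simp
    qed
    also have "\<dots> \<le> 3 * x" unfolding x_def exp_add using exp_le by (intro mult_right_mono) auto
    finally show "5 * real n * (1 - 2 / (3 * n)) ^ T \<le> 5 * real n * (3 * x)" by (intro mult_left_mono) auto
  next
    have "(1 + 2 * (149 / 100) / n) ^ T \<le> exp (298 / 100 / n) ^ T"
      using exp_ge_add_one_self[of "298 / 100 / real n"] by (intro power_mono) auto
    also have "\<dots> = exp (298 / 100 / n * T)" by (simp add: exp_of_nat_mult[symmetric] mult.commute)
    also have "\<dots> \<le> exp (2086 / 100 * L)"
    proof -
      have "298 / 100 / n * T \<le> 298 / 100 / n * (7 * real n * L)" using T by (intro mult_left_mono) auto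
      thus ?thesis using n by simp
    qed
    finally have "(1 + 2 * (149 / 100) / n) ^ T / 2 powr (36 * L) \<le> exp (2086 / 100 * L) / 2 powr (36 * L)"
      by (intro divide_right_mono) auto
    also have "\<dots> = exp (2086 / 100 * L - 36 * ln 2 * L)" by (simp add: powr_def exp_diff mult_ac)
    also have "\<dots> \<le> x"
    proof -
      have "36 * (173 / 250) * L \<le> 36 * ln 2 * L" using ln_2_ge L1 by (intro mult_right_mono) auto
      hence "2086 / 100 * L - 36 * ln 2 * L \<le> - 4 * L" using L1 by linarith
      thus ?thesis unfolding x_def by (simp only: exp_le_cancel_iff)
    qed
    finally show "4 * real n * (1 + 2 * (149 / 100) / n) ^ T / 2 powr (36 * L) \<le> 4 * real n * x"
      unfolding times_divide_eq_right[symmetric] by (intro mult_left_mono) auto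
  qed
  also have "\<dots> = 20 * (n * x)" by simp
  also have "\<dots> = 20 / real n ^ 3" using \<open>n * x = 1 / real n ^ 3\<close> by simp
  finally show ?thesis by (simp add: T_def L_def)
qed

theorem theorem2:
  "\<exists>C::real. \<forall>(n::nat) (p::real) (s::nat).
     s < n \<longrightarrow> 86 * ln (real n) / real n \<le> p \<longrightarrow> p \<le> 1 \<longrightarrow>
     measure_pmf.prob (dra_on_gnp n p s (nat \<lfloor>7 * real n * ln (real n)\<rfloor>)) (constructs_ham_cycle n)
       \<ge> 1 - C / real n ^ 3"
proof -
  have "eventually (\<lambda>n. 1000 \<le> n \<and> 10000 * ln (real n) \<le> real n) sequentially"
    by (intro eventually_conj eventually_ge_at_top) real_asymp
  then obtain N where N: "\<And>n. N \<le> n \<Longrightarrow> 1000 \<le> n \<and> 10000 * ln (real n) \<le> real n"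
    by (auto simp: eventually_at_top_linorder)
  \<comment> \<open>The second entry makes the claimed lower bound nonpositive for every
    \<open>n\<close> below \<open>N\<close>.\<close>
  define C where "C = max 20 (real N ^ 3)"
  have "1 - C / real n ^ 3 \<le>
      measure_pmf.prob (dra_on_gnp n p s (nat \<lfloor>7 * real n * ln (real n)\<rfloor>)) (constructs_ham_cycle n)"
    if "s < n" "86 * ln (real n) / real n \<le> p" "p \<le> 1" for n p s
  proof (cases "N \<le> n")
    case True
    have "20 / real n ^ 3 \<le> C / real n ^ 3" unfolding C_def by (intro divide_right_mono) auto
    with success_probability_large[OF that] N[OF True] show ?thesis by force
  next
    case False
    have "real n ^ 3 \<le> C" unfolding C_def using False by (intro max.coboundedI2 power_mono) auto
    hence "1 \<le> C / real n ^ 3" using that(1) by simp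
    thus ?thesis using measure_nonneg[of "dra_on_gnp n p s (nat \<lfloor>7 * real n * ln (real n)\<rfloor>)" "constructs_ham_cycle n"]
      by linarith
  qed
  thus ?thesis by blast
qed

end
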